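(* For any integer $k\geq0$, any class of weighted graphs of treewidth at most $k$ has Assouad--Nagata dimension at most $1$.
   Context: All graphs are finite. A weighted graph has edge weights in $\mathbb{R}^+\cup\{\infty\}$ ($\mathbb{R}^+$ the strictly positive reals); $\mathrm{dist}_G$ is the shortest path length and treewidth is that of the underlying graph. $\mathrm{wdiam}_G(S)=\max_{u,v\in S}\mathrm{dist}_G(u,v)$. For $r>0$ an $r$-path is a sequence of vertices with consecutive vertices at distance at most $r$ in $G$. A map $c:V(G)\to C$, $|C|=m$, is an $(m,r,d)$-colouring if every $r$-path in $G$ whose vertices all receive the same colour has weak diameter in $G$ at most $d$. $f:\mathbb{R}^+\to\mathbb{R}^+$ is an $n$-dimensional control function for a class if every member admits an $(n+1,r,f(r))$-colouring for every $r>0$. $f$ is a dilation if $f(r)\leq cr$ for some $c>0$ and all $r>0$. The Assouad--Nagata dimension of a class is the least $n\geq0$ such that the class admits an $n$-dimensional control function that is a dilation ($\infty$ if none). *)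

theory Defs
  imports Complex_Main "HOL-Library.Extended_Nat" "HOL-Library.Extended_Nonnegative_Real"
begin

record 'a ugraph =
  verts :: "'a set"
  edges :: "'a set set"

definition finite_graph :: "('a, 'b) ugraph_scheme \<Rightarrow> bool" where
  "finite_graph G \<longleftrightarrow> finite (verts G) \<and>
     (\<forall>e\<in>edges G. \<exists>u\<in>verts G. \<exists>v\<in>verts G. u \<noteq> v \<and> e = {u, v})"

fun path_edges :: "'a list \<Rightarrow> 'a set list" where
  "path_edges (x # y # xs) = {x, y} # path_edges (y # xs)"
| "path_edges _ = []"

definition graph_path :: "('a, 'b) ugraph_scheme \<Rightarrow> 'a \<Rightarrow> 'a list \<Rightarrow> 'a \<Rightarrow> bool" where
  "graph_path G u p v \<longleftrightarrow> p \<noteq> [] \<and> hd p = u \<and> last p = v \<and> distinct p \<and>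
     set p \<subseteq> verts G \<and> set (path_edges p) \<subseteq> edges G"

definition graph_cycle :: "('a, 'b) ugraph_scheme \<Rightarrow> 'a list \<Rightarrow> bool" where
  "graph_cycle G p \<longleftrightarrow> length p \<ge> 3 \<and> distinct p \<and> set p \<subseteq> verts G \<and>
     set (path_edges p) \<subseteq> edges G \<and> {last p, hd p} \<in> edges G"

definition graph_connected :: "('a, 'b) ugraph_scheme \<Rightarrow> bool" where
  "graph_connected G \<longleftrightarrow> verts G \<noteq> {} \<and> (\<forall>u\<in>verts G. \<forall>v\<in>verts G. \<exists>p. graph_path G u p v)"

definition induced_subgraph :: "('a, 'b) ugraph_scheme \<Rightarrow> 'a set \<Rightarrow> 'a ugraph" where
  "induced_subgraph G S = \<lparr>verts = verts G \<inter> S, edges = {e \<in> edges G. e \<subseteq> S}\<rparr>"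

definition finite_tree :: "'a ugraph \<Rightarrow> bool" where
  "finite_tree T \<longleftrightarrow> finite_graph T \<and> graph_connected T \<and> (\<nexists>p. graph_cycle T p)"

definition tree_decomposition ::
    "('a, 'b) ugraph_scheme \<Rightarrow> 't ugraph \<Rightarrow> ('t \<Rightarrow> 'a set) \<Rightarrow> bool" where
  "tree_decomposition G T B \<longleftrightarrow> finite_tree T \<and>
     (\<Union>t\<in>verts T. B t) = verts G \<and>
     (\<forall>e\<in>edges G. \<exists>t\<in>verts T. e \<subseteq> B t) \<and>
     (\<forall>v\<in>verts G. graph_connected (induced_subgraph T {t. v \<in> B t}))"

(* Truncated subtraction only matters for the graph without vertices, whose width is then
   0 rather than -1; this does not affect a bound "treewidth at most k" with k a natural number. *)
definition decomposition_width :: "'t ugraph \<Rightarrow> ('t \<Rightarrow> 'a set) \<Rightarrow> nat" where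
  "decomposition_width T B = Max ((\<lambda>t. card (B t)) ` verts T) - 1"

(* Decomposition trees are finite, so natural numbers suffice as tree nodes.  The single-bag
   decomposition shows that LEAST ranges over a nonempty set when G is a finite graph. *)
definition treewidth :: "('a, 'b) ugraph_scheme \<Rightarrow> nat" where
  "treewidth G = (LEAST w. \<exists>(T :: nat ugraph) B. tree_decomposition G T B \<and> decomposition_width T B = w)"

record 'a wgraph = "'a ugraph" +
  weight :: "'a set \<Rightarrow> ennreal"

definition weighted_graph :: "'a wgraph \<Rightarrow> bool" where
  "weighted_graph G \<longleftrightarrow> finite_graph G \<and> (\<forall>e\<in>edges G. 0 < weight G e)"

definition path_length :: "'a wgraph \<Rightarrow> 'a list \<Rightarrow> ennreal" where
  "path_length G p = sum_list (map (weight G) (path_edges p))"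

(* The infimum is a minimum if a path exists (G is finite), and is \<infinity> otherwise. *)
definition wdist :: "'a wgraph \<Rightarrow> 'a \<Rightarrow> 'a \<Rightarrow> ennreal" where
  "wdist G u v = (INF p\<in>{p. graph_path G u p v}. path_length G p)"

definition wdiam :: "'a wgraph \<Rightarrow> 'a set \<Rightarrow> ennreal" where
  "wdiam G S = (SUP u\<in>S. SUP v\<in>S. wdist G u v)"

definition r_path :: "'a wgraph \<Rightarrow> real \<Rightarrow> 'a list \<Rightarrow> bool" where
  "r_path G r p \<longleftrightarrow> p \<noteq> [] \<and> set p \<subseteq> verts G \<and>
     (\<forall>i. Suc i < length p \<longrightarrow> wdist G (p ! i) (p ! Suc i) \<le> ennreal r)"

definition mrd_colouring ::
    "'a wgraph \<Rightarrow> nat \<Rightarrow> real \<Rightarrow> real \<Rightarrow> 'c set \<Rightarrow> ('a \<Rightarrow> 'c) \<Rightarrow> bool" where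
  "mrd_colouring G m r d C c \<longleftrightarrow> finite C \<and> card C = m \<and> c ` verts G \<subseteq> C \<and>
     (\<forall>p. r_path G r p \<and> (\<exists>a. \<forall>x\<in>set p. c x = a) \<longrightarrow> wdiam G (set p) \<le> ennreal d)"

definition control_function :: "'a wgraph set \<Rightarrow> nat \<Rightarrow> (real \<Rightarrow> real) \<Rightarrow> bool" where
  "control_function \<G> n f \<longleftrightarrow> (\<forall>r>0. f r > 0) \<and>
     (\<forall>G\<in>\<G>. \<forall>r>0. \<exists>(C :: nat set) c. mrd_colouring G (n + 1) r (f r) C c)"

definition dilation :: "(real \<Rightarrow> real) \<Rightarrow> bool" where
  "dilation f \<longleftrightarrow> (\<exists>c>0. \<forall>r>0. f r \<le> c * r)"

definition assouad_nagata_dim :: "'a wgraph set \<Rightarrow> enat" where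
  "assouad_nagata_dim \<G> = (INF n\<in>{n. \<exists>f. control_function \<G> n f \<and> dilation f}. enat n)"

end

(* Assouad-Nagata dimension at most 1 asks for 2-colourings whose monochromatic r-components have
   diameter linear in r.  After rescaling the weights r = 1, so only a bound D that depends on the
   treewidth is needed.  By induction on the size k of the bags one proves more: every precolouring
   p of the R-neighbourhood Z of the root bag X extends to such a colouring.

   Consider the top part V of the decomposition, where bags contain points of Z.  On V - Z the bags are
   smaller, provided that distances are replaced by the path metric of those steps that have no
   shortcut through Z; the induction hypothesis, applied with a larger step r1, colours V - Z.  Since
   Z is covered by few balls, putting it back only increases the bound.  Below V hang branches W,
   attached through adhesion sets A disjoint from Z.  They are coloured recursively, where around A
   three layers of width r are prescribed: the colour of a nearby point of A, then True, then False.
   No monochromatic walk crosses the last two layers.  Hence such a walk either stays inside one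
   branch, far from A, or its excursions into branches stay near adhesion sets and can be
   shortcut to a monochromatic r1-walk in V. *)

theory Submission
  imports Defs
begin

section \<open>Monochromatic walks\<close>

definition pseudometric :: "('a \<Rightarrow> 'a \<Rightarrow> ennreal) \<Rightarrow> bool" where
  "pseudometric d \<longleftrightarrow>
     (\<forall>x. d x x = 0) \<and> (\<forall>x y. d x y = d y x) \<and> (\<forall>x y z. d x z \<le> d x y + d y z)"

definition dist_le :: "('a \<Rightarrow> 'a \<Rightarrow> ennreal) \<Rightarrow> nat \<Rightarrow> 'a \<Rightarrow> 'a \<Rightarrow> bool" where
  "dist_le d n x y \<longleftrightarrow> d x y \<le> of_nat n"

definition near :: "('a \<Rightarrow> 'a \<Rightarrow> ennreal) \<Rightarrow> nat \<Rightarrow> 'a set \<Rightarrow> 'a \<Rightarrow> bool" where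
  "near d n A x \<longleftrightarrow> (\<exists>a\<in>A. dist_le d n x a)"

definition mono_step ::
    "('a \<Rightarrow> 'a \<Rightarrow> ennreal) \<Rightarrow> 'a set \<Rightarrow> ('a \<Rightarrow> bool) \<Rightarrow> nat \<Rightarrow> 'a \<Rightarrow> 'a \<Rightarrow> bool" where
  "mono_step d S c r x y \<longleftrightarrow> x \<in> S \<and> y \<in> S \<and> c x = c y \<and> dist_le d r x y"

definition mono_bounded ::
    "('a \<Rightarrow> 'a \<Rightarrow> ennreal) \<Rightarrow> 'a set \<Rightarrow> ('a \<Rightarrow> bool) \<Rightarrow> nat \<Rightarrow> nat \<Rightarrow> bool" where
  "mono_bounded d S c r D \<longleftrightarrow> (\<forall>x y. (mono_step d S c r)\<^sup>*\<^sup>* x y \<longrightarrow> dist_le d D x y)"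

lemma dist_le_refl: "pseudometric d \<Longrightarrow> dist_le d n x x"
  by (simp add: pseudometric_def dist_le_def)

lemma dist_le_sym: "pseudometric d \<Longrightarrow> dist_le d n x y \<Longrightarrow> dist_le d n y x"
  by (simp add: pseudometric_def dist_le_def)

lemma dist_le_mono: "dist_le d m x y \<Longrightarrow> m \<le> n \<Longrightarrow> dist_le d n x y"
  unfolding dist_le_def by (erule order_trans) (rule of_nat_mono)

lemma dist_le_trans:
  assumes "pseudometric d" "dist_le d m x y" "dist_le d n y z" "m + n \<le> l"
  shows "dist_le d l x z"
proof -
  have "d x z \<le> d x y + d y z"
    using assms(1) by (simp add: pseudometric_def)
  also have "\<dots> \<le> of_nat m + of_nat n"
    using assms(2,3) by (intro add_mono) (auto simp: dist_le_def)
  finally have "dist_le d (m + n) x z"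
    by (simp add: dist_le_def)
  then show ?thesis
    using assms(4) by (rule dist_le_mono)
qed

lemma mono_step_rtranclp_sym:
  assumes "pseudometric d" "(mono_step d S c r)\<^sup>*\<^sup>* x y"
  shows "(mono_step d S c r)\<^sup>*\<^sup>* y x"
proof -
  have "symp (mono_step d S c r)"
    using dist_le_sym[OF assms(1)] by (auto intro!: sympI simp: mono_step_def)
  then show ?thesis
    using assms(2) by (blast dest: symp_rtranclp sympD)
qed

lemma mono_step_rtranclp_mono:
  assumes "(mono_step d S c r)\<^sup>*\<^sup>* x y"
    and "\<And>x y. mono_step d S c r x y \<Longrightarrow> mono_step d' S' c' r' x y"
  shows "(mono_step d' S' c' r')\<^sup>*\<^sup>* x y"
  using assms(1)
proof (induction rule: rtranclp_induct)
  case (step y z)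
  show ?case
    by (rule rtranclp.rtrancl_into_rtrancl[OF step.IH assms(2)[OF step.hyps(2)]])
qed simp

lemma mono_step_rtranclp_colour: "(mono_step d S c r)\<^sup>*\<^sup>* x y \<Longrightarrow> c x = c y"
  by (induction rule: rtranclp_induct) (auto simp: mono_step_def)

text \<open>A monochromatic walk is cut at its first and at its last visit to the ball.\<close>

lemma mono_bounded_add_ball:
  assumes d: "pseudometric d" and b: "mono_bounded d {x \<in> S. \<not> dist_le d m x x0} c r D"
  shows "mono_bounded d S c r (2 * (D + r + m))"
proof -
  let ?T = "{x \<in> S. \<not> dist_le d m x x0}"
  \<comment> \<open>The second alternative bounds the start \<open>x\<close> only, so it is applied
    both to the walk and to its reversal.\<close>
  have cut: "(mono_step d ?T c r)\<^sup>*\<^sup>* x y \<or> dist_le d (D + r + m) x x0"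
    if "(mono_step d S c r)\<^sup>*\<^sup>* x y" for x y
    using that
  proof (induction rule: rtranclp_induct)
    case base
    then show ?case by simp
  next
    case (step y z)
    show ?case
    proof (cases "dist_le d (D + r + m) x x0")
      case False
      then have xy: "(mono_step d ?T c r)\<^sup>*\<^sup>* x y"
        using step.IH by simp
      then have D: "dist_le d D x y"
        using b by (simp add: mono_bounded_def)
      have r: "dist_le d r y z"
        using step.hyps by (simp add: mono_step_def)
      have "\<not> dist_le d m y x0"
        using False dist_le_trans[OF d D, of m x0 "D + r + m"] by auto
      moreover have "\<not> dist_le d m z x0"
        using False dist_le_trans[OF d dist_le_trans[OF d D r order_refl], of m x0 "D + r + m"] by auto
      ultimately have "mono_step d ?T c r y z"
        using step.hyps by (simp add: mono_step_def)
      with xy show ?thesis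
        by (simp add: rtranclp.rtrancl_into_rtrancl)
    qed simp
  qed
  show ?thesis
    unfolding mono_bounded_def
  proof (intro allI impI)
    fix x y
    assume xy: "(mono_step d S c r)\<^sup>*\<^sup>* x y"
    show "dist_le d (2 * (D + r + m)) x y"
    proof (cases "(mono_step d ?T c r)\<^sup>*\<^sup>* x y")
      case True
      then have "dist_le d D x y"
        using b by (simp add: mono_bounded_def)
      then show ?thesis
        by (rule dist_le_mono) simp
    next
      case False
      moreover have "\<not> (mono_step d ?T c r)\<^sup>*\<^sup>* y x"
        using False mono_step_rtranclp_sym[OF d] by blast
      ultimately have "dist_le d (D + r + m) x x0" "dist_le d (D + r + m) y x0"
        using cut[OF xy] cut[OF mono_step_rtranclp_sym[OF d xy]] by simp_all
      then show ?thesis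
        using dist_le_trans[OF d _ dist_le_sym[OF d], of "D + r + m" x x0 "D + r + m" y] by simp
    qed
  qed
qed

text \<open>Each unfolding is one use of \<open>mono_bounded_add_ball\<close>. The value depends on
  the number of balls and on no other feature of the graph.\<close>

primrec absorbed_bound :: "nat \<Rightarrow> nat \<Rightarrow> nat \<Rightarrow> nat \<Rightarrow> nat" where
  "absorbed_bound r m D 0 = D"
| "absorbed_bound r m D (Suc n) = 2 * (absorbed_bound r m D n + r + m)"

lemma absorbed_bound_mono: "n \<le> n' \<Longrightarrow> absorbed_bound r m D n \<le> absorbed_bound r m D n'"
  by (rule lift_Suc_mono_le[of "absorbed_bound r m D"]) auto

lemma mono_bounded_weaken: "mono_bounded d S c r D \<Longrightarrow> D \<le> D' \<Longrightarrow> mono_bounded d S c r D'"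
  unfolding mono_bounded_def by (intro allI impI) (rule dist_le_mono, auto)

text \<open>The balls are put back one at a time. \<open>S\<close> varies in the induction because
  the ball around \<open>x0\<close> is removed first and the other centres are treated in what
  remains.\<close>

lemma mono_bounded_absorb:
  assumes d: "pseudometric d" and "finite X" "card X \<le> k"
    and "mono_bounded d {x \<in> S. \<not> near d m X x} c r D"
  shows "mono_bounded d S c r (absorbed_bound r m D k)"
proof -
  have "mono_bounded d S c r (absorbed_bound r m D (card X))"
    using assms(2,4)
  proof (induction X arbitrary: S rule: finite_induct)
    case empty
    then show ?case by (simp add: near_def)
  next
    case (insert x0 X)
    let ?T = "{x \<in> S. \<not> dist_le d m x x0}"
    have "{x \<in> ?T. \<not> near d m X x} = {x \<in> S. \<not> near d m (insert x0 X) x}"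
      by (auto simp: near_def)
    then have "mono_bounded d ?T c r (absorbed_bound r m D (card X))"
      using insert.IH[of ?T] insert.prems by simp
    from mono_bounded_add_ball[OF d this] show ?case
      using insert.hyps by simp
  qed
  then show ?thesis
    using absorbed_bound_mono[OF assms(3)] by (rule mono_bounded_weaken)
qed

section \<open>Path metrics and gated sets\<close>

text \<open>Metric form of the separation property: every connection between \<open>W\<close> and the rest of \<open>H\<close>
  passes through a point of \<open>A\<close> that lies between the two ends.\<close>

definition gated :: "('a \<Rightarrow> 'a \<Rightarrow> ennreal) \<Rightarrow> 'a set \<Rightarrow> 'a set \<Rightarrow> 'a set \<Rightarrow> bool" where
  "gated d H A W \<longleftrightarrow>
     (\<forall>u\<in>W. \<forall>v\<in>H - W. d u v < top \<longrightarrow> (\<exists>z\<in>A. d u z + d z v \<le> d u v))"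

text \<open>Walks may revisit points, unlike \<open>graph_path\<close>, so they can be concatenated
  freely; a forbidden step is one of weight \<open>top\<close>.\<close>

inductive walk_length :: "('a \<Rightarrow> 'a \<Rightarrow> ennreal) \<Rightarrow> 'a \<Rightarrow> 'a \<Rightarrow> ennreal \<Rightarrow> bool" for w where
  walk_Nil: "walk_length w x x 0"
| walk_snoc: "walk_length w x y t \<Longrightarrow> walk_length w x z (t + w y z)"

definition path_metric :: "('a \<Rightarrow> 'a \<Rightarrow> ennreal) \<Rightarrow> 'a \<Rightarrow> 'a \<Rightarrow> ennreal" where
  "path_metric w x y = Inf {t. walk_length w x y t}"

lemma path_metric_le: "walk_length w x y t \<Longrightarrow> path_metric w x y \<le> t"
  by (simp add: path_metric_def Inf_lower)

lemma path_metric_le_weight: "path_metric w x y \<le> w x y"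
  using path_metric_le[OF walk_snoc[OF walk_Nil[of w x]], of y] by simp

lemma walk_length_append:
  assumes "walk_length w y z t" "walk_length w x y s"
  shows "walk_length w x z (s + t)"
  using assms
proof (induction rule: walk_length.induct)
  case (walk_snoc y v t z)
  then show ?case
    using walk_length.walk_snoc[of w x v "s + t" z] by (simp add: add.assoc)
qed simp

lemma walk_length_sym:
  assumes "\<And>x y. w x y = w y x" "walk_length w x y t"
  shows "walk_length w y x t"
  using assms(2)
proof (induction rule: walk_length.induct)
  case (walk_snoc x y t z)
  have "walk_length w z y (w y z)"
    using walk_length.walk_snoc[OF walk_Nil, of w z y] assms(1) by simp
  from walk_length_append[OF walk_snoc.IH this] show ?case
    by (simp add: add.commute)
qed (rule walk_Nil)

text \<open>The infimum need not be attained, so two walks, each within \<open>e / 2\<close> of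
  optimal, are concatenated.\<close>

lemma path_metric_triangle: "path_metric w x z \<le> path_metric w x y + path_metric w y z"
proof (rule ennreal_le_epsilon)
  fix e :: real
  assume fin: "path_metric w x y + path_metric w y z < top" and e: "0 < e"
  have less: "a < a + ennreal (e / 2)" if "a < top" for a
    using that e ennreal_add_left_cancel_less[of a 0 "ennreal (e / 2)"] by simp
  have "path_metric w x y < path_metric w x y + ennreal (e / 2)"
    "path_metric w y z < path_metric w y z + ennreal (e / 2)"
    using fin e by (auto intro: less)
  then obtain s t where st: "walk_length w x y s" "s < path_metric w x y + ennreal (e / 2)"
    "walk_length w y z t" "t < path_metric w y z + ennreal (e / 2)"
    unfolding path_metric_def Inf_less_iff by auto
  have "path_metric w x z \<le> s + t"
    by (rule path_metric_le[OF walk_length_append[OF st(3,1)]])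
  also have "\<dots> \<le> (path_metric w x y + ennreal (e / 2)) + (path_metric w y z + ennreal (e / 2))"
    using st by (intro add_mono) auto
  also have "\<dots> = path_metric w x y + path_metric w y z + (ennreal (e / 2) + ennreal (e / 2))"
    by (simp add: ac_simps)
  also have "ennreal (e / 2) + ennreal (e / 2) = ennreal e"
    using e by (simp flip: ennreal_plus)
  finally show "path_metric w x z \<le> path_metric w x y + path_metric w y z + ennreal e" .
qed

lemma pseudometric_path_metric:
  assumes "\<And>x y. w x y = w y x"
  shows "pseudometric (path_metric w)"
proof -
  have "{t. walk_length w x y t} = {t. walk_length w y x t}" for x y
    using walk_length_sym[of w, OF assms] by blast
  moreover have "path_metric w x x = 0" for x
    using path_metric_le[OF walk_Nil[of w x]] by simp
  ultimately show ?thesis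
    using path_metric_triangle by (auto simp: pseudometric_def path_metric_def)
qed

text \<open>Triangle inequality along the walk: for symmetric \<open>w\<close> the path metric is
  the greatest pseudometric below \<open>w\<close>. Bounds found in a deletion metric return to
  \<open>d\<close> this way.\<close>

lemma path_metric_ge:
  assumes "pseudometric d" "\<And>x y. d x y \<le> w x y"
  shows "d x y \<le> path_metric w x y"
  unfolding path_metric_def
proof (rule Inf_greatest, clarify)
  fix t
  assume "walk_length w x y t"
  then show "d x y \<le> t"
  proof (induction rule: walk_length.induct)
    case (walk_Nil x)
    then show ?case using assms(1) by (simp add: pseudometric_def)
  next
    case (walk_snoc x y t z)
    have "d x z \<le> d x y + d y z"
      using assms(1) by (simp add: pseudometric_def)
    also have "\<dots> \<le> t + w y z"
      using walk_snoc.IH assms(2) by (intro add_mono) auto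
    finally show ?case .
  qed
qed

text \<open>Induction on the last step, from \<open>y\<close> to \<open>z\<close>. If
  \<open>y\<close> is in \<open>W\<close>, this step crosses and its own gate serves; otherwise the
  shorter walk has already crossed, and its gate is kept.\<close>

lemma walk_length_gate:
  assumes "walk_length w u v t" "u \<in> W" "v \<in> H - W" "t < top"
    and top: "\<And>x y. x \<notin> H \<Longrightarrow> w x y = top"
    and gate: "\<And>x y. x \<in> W \<Longrightarrow> y \<in> H - W \<Longrightarrow> w x y < top \<Longrightarrow>
      \<exists>z\<in>A. path_metric w x z + path_metric w z y \<le> w x y"
  shows "\<exists>z\<in>A. path_metric w u z + path_metric w z v \<le> t"
  using assms(1-4)
proof (induction rule: walk_length.induct)
  case (walk_snoc x y t z)
  then have fin: "t < top" "w y z < top"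
    by (auto simp: ennreal_add_eq_top less_top[symmetric])
  then have "y \<in> H"
    using top[of y z] by (cases "y \<in> H") simp_all
  show ?case
  proof (cases "y \<in> W")
    case True
    then obtain a where a: "a \<in> A" "path_metric w y a + path_metric w a z \<le> w y z"
      using gate walk_snoc.prems fin by blast
    have "path_metric w x a + path_metric w a z
        \<le> path_metric w x y + path_metric w y a + path_metric w a z"
      by (intro add_right_mono path_metric_triangle)
    also have "\<dots> \<le> t + w y z"
      using a(2) path_metric_le[OF walk_snoc.hyps] by (simp add: add.assoc add_mono)
    finally show ?thesis using a(1) by blast
  next
    case False
    then obtain a where a: "a \<in> A" "path_metric w x a + path_metric w a y \<le> t"
      using walk_snoc.IH walk_snoc.prems fin \<open>y \<in> H\<close> by blast
    have "path_metric w x a + path_metric w a z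
        \<le> path_metric w x a + (path_metric w a y + path_metric w y z)"
      by (intro add_left_mono path_metric_triangle)
    also have "\<dots> \<le> t + w y z"
      using a(2) path_metric_le_weight[of w y z] by (simp add: add.assoc[symmetric] add_mono)
    finally show ?thesis using a(1) by blast
  qed
qed simp

text \<open>Gates need checking only for single steps. As \<open>A\<close> is finite, failure at
  every gate leaves a positive margin, so a single walk beats all gates at once, against
  \<open>walk_length_gate\<close>.\<close>

lemma gated_path_metric:
  assumes "finite A" and top: "\<And>x y. x \<notin> H \<Longrightarrow> w x y = top"
    and gate: "\<And>x y. x \<in> W \<Longrightarrow> y \<in> H - W \<Longrightarrow> w x y < top \<Longrightarrow>
      \<exists>z\<in>A. path_metric w x z + path_metric w z y \<le> w x y"
  shows "gated (path_metric w) H A W"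
  unfolding gated_def
proof (intro ballI impI)
  fix u v
  assume uv: "u \<in> W" "v \<in> H - W" and fin: "path_metric w u v < top"
  \<comment> \<open>Including \<open>top\<close> keeps the set nonempty and forces the walk found
    below to have finite length.\<close>
  let ?M = "insert top ((\<lambda>z. path_metric w u z + path_metric w z v) ` A)"
  have "finite ?M" using assms(1) by simp
  show "\<exists>z\<in>A. path_metric w u z + path_metric w z v \<le> path_metric w u v"
  proof (rule ccontr)
    assume "\<not> ?thesis"
    then have "path_metric w u v < Min ?M"
      using \<open>finite ?M\<close> fin by (subst Min_gr_iff) auto
    then obtain t where t: "walk_length w u v t" "t < Min ?M"
      unfolding path_metric_def[of w u v] Inf_less_iff by auto
    then have "t < top" "\<forall>z\<in>A. t < path_metric w u z + path_metric w z v"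
      using \<open>finite ?M\<close> by auto
    with walk_length_gate[OF t(1) uv _ top gate] show False
      by (auto simp: not_le[symmetric])
  qed
qed

section \<open>Rooted decompositions\<close>

text \<open>The parameters are a condition \<open>P\<close> on bags, the ambient point set \<open>H\<close>, the root bag and the set
  of all points covered by bags.\<close>

inductive rooted_decomp ::
    "('a \<Rightarrow> 'a \<Rightarrow> ennreal) \<Rightarrow> ('a set \<Rightarrow> bool) \<Rightarrow> 'a set \<Rightarrow> 'a set \<Rightarrow> 'a set \<Rightarrow> bool"
  for d P H where
  leaf: "P X \<Longrightarrow> rooted_decomp d P H X X"
| glue: "rooted_decomp d P H X V \<Longrightarrow> rooted_decomp d P H Y W \<Longrightarrow> V \<inter> W \<subseteq> X \<inter> Y \<Longrightarrow>
    gated d H (X \<inter> Y) W \<Longrightarrow> rooted_decomp d P H X (V \<union> W)"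

lemma rooted_decomp_root: "rooted_decomp d P H X V \<Longrightarrow> P X \<and> X \<subseteq> V"
  by (induction rule: rooted_decomp.induct) auto

text \<open>Discarding steps with a shortcut through \<open>Z\<close> makes the gates of the remaining steps avoid \<open>Z\<close>, so
  that gated sets stay gated after the deletion of \<open>Z\<close>.\<close>

definition deletion_weight ::
    "('a \<Rightarrow> 'a \<Rightarrow> ennreal) \<Rightarrow> 'a set \<Rightarrow> 'a set \<Rightarrow> 'a \<Rightarrow> 'a \<Rightarrow> ennreal" where
  "deletion_weight d Z V x y =
     (if x \<in> V - Z \<and> y \<in> V - Z \<and> \<not> (\<exists>z\<in>Z. d x z + d z y \<le> d x y) then d x y else top)"

lemma deletion_weight_sym:
  assumes "pseudometric d"
  shows "deletion_weight d Z V x y = deletion_weight d Z V y x"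
proof -
  have "d x y = d y x" for x y
    using assms by (simp add: pseudometric_def)
  then show ?thesis
    by (simp add: deletion_weight_def add.commute conj_ac)
qed

text \<open>A gate of a surviving step is not in \<open>Z\<close>, as it would be a shortcut. Both
  halves of the step survive too, because a shortcut of one half through \<open>Z\<close> would be a
  shortcut of the whole.\<close>

lemma gated_deletion:
  assumes d: "pseudometric d" and g: "gated d H A W" and "V \<subseteq> H" "A \<subseteq> V" "finite A"
  shows "gated (path_metric (deletion_weight d Z V)) (V - Z) (A - Z) (W - Z)"
proof (rule gated_path_metric)
  let ?w = "deletion_weight d Z V"
  fix x y
  assume x: "x \<in> W - Z" and y: "y \<in> (V - Z) - (W - Z)" and fin: "?w x y < top"
  then have xV: "x \<in> V - Z" and no: "\<And>z. z \<in> Z \<Longrightarrow> \<not> d x z + d z y \<le> d x y"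
    and w: "?w x y = d x y"
    by (auto simp: deletion_weight_def split: if_splits)
  have "x \<in> W" "y \<in> H - W" "d x y < top"
    using x y fin w \<open>V \<subseteq> H\<close> by auto
  then obtain z where z: "z \<in> A" "d x z + d z y \<le> d x y"
    using g unfolding gated_def by blast
  then have zV: "z \<in> V - Z"
    using no \<open>A \<subseteq> V\<close> by blast
  have tri: "d a c \<le> d a b + d b c" for a b c
    using d by (simp add: pseudometric_def)
  have "\<not> d x v + d v z \<le> d x z" if "v \<in> Z" for v
  proof
    assume "d x v + d v z \<le> d x z"
    then have "d x v + d v z + d z y \<le> d x z + d z y"
      by (rule add_right_mono)
    moreover have "d x v + d v y \<le> d x v + (d v z + d z y)"
      by (intro add_left_mono tri)
    ultimately have "d x v + d v y \<le> d x y"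
      using z(2) unfolding add.assoc by (meson order_trans)
    then show False
      using no[OF that] by simp
  qed
  moreover have "\<not> d z v + d v y \<le> d z y" if "v \<in> Z" for v
  proof
    assume "d z v + d v y \<le> d z y"
    then have "d x z + (d z v + d v y) \<le> d x z + d z y"
      by (rule add_left_mono)
    moreover have "d x v + d v y \<le> d x z + d z v + d v y"
      by (intro add_right_mono tri)
    ultimately have "d x v + d v y \<le> d x y"
      using z(2) unfolding add.assoc by (meson order_trans)
    then show False
      using no[OF that] by simp
  qed
  ultimately have "?w x z = d x z" "?w z y = d z y"
    using xV zV y by (auto simp: deletion_weight_def)
  then have "path_metric ?w x z + path_metric ?w z y \<le> d x z + d z y"
    using path_metric_le_weight[of ?w x z] path_metric_le_weight[of ?w z y]
    by (simp add: add_mono)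
  also have "\<dots> \<le> ?w x y"
    using z(2) w by simp
  finally have "path_metric ?w x z + path_metric ?w z y \<le> ?w x y" .
  then show "\<exists>z\<in>A - Z. path_metric ?w x z + path_metric ?w z y \<le> ?w x y"
    using z(1) zV by blast
qed (use assms in \<open>auto simp: deletion_weight_def\<close>)

text \<open>The metric is fixed by the whole set \<open>V1\<close>, while the induction runs through
  the parts \<open>V\<close> of it.\<close>

lemma rooted_decomp_deletion:
  assumes "rooted_decomp d P H X V" and d: "pseudometric d"
    and P: "\<And>B. P B \<Longrightarrow> finite B \<and> P' (B - Z)" and "V \<subseteq> V1" "V1 \<subseteq> H"
  shows "rooted_decomp (path_metric (deletion_weight d Z V1)) P' (V1 - Z) (X - Z) (V - Z)"
  using assms(1,4)
proof (induction rule: rooted_decomp.induct)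
  case (leaf X)
  then show ?case using P by (auto intro: rooted_decomp.leaf)
next
  case (glue X V Y W)
  have X: "finite (X \<inter> Y)" "X \<inter> Y \<subseteq> V1"
    using rooted_decomp_root[OF glue.hyps(1)] P glue.prems by auto
  have XY: "(X - Z) \<inter> (Y - Z) = X \<inter> Y - Z"
    by auto
  have "rooted_decomp (path_metric (deletion_weight d Z V1)) P' (V1 - Z) (X - Z) ((V - Z) \<union> (W - Z))"
  proof (rule rooted_decomp.glue)
    show "gated (path_metric (deletion_weight d Z V1)) (V1 - Z) ((X - Z) \<inter> (Y - Z)) (W - Z)"
      unfolding XY using gated_deletion[OF d glue.hyps(4) \<open>V1 \<subseteq> H\<close> X(2,1)] .
    show "rooted_decomp (path_metric (deletion_weight d Z V1)) P' (V1 - Z) (X - Z) (V - Z)"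
      "rooted_decomp (path_metric (deletion_weight d Z V1)) P' (V1 - Z) (Y - Z) (W - Z)"
      using glue by auto
  qed (use glue.hyps in auto)
  then show ?case by (simp add: Un_Diff)
qed

lemma gated_antimono: "gated d H A W \<Longrightarrow> H' \<subseteq> H \<Longrightarrow> gated d H' A W"
  unfolding gated_def by blast

lemma rooted_decomp_antimono:
  assumes "rooted_decomp d P H X V" "H' \<subseteq> H"
  shows "rooted_decomp d P H' X V"
  using assms(1)
proof (induction rule: rooted_decomp.induct)
  case (glue X V Y W)
  then show ?case
    using gated_antimono[OF _ assms(2)] by (intro rooted_decomp.glue) auto
qed (rule rooted_decomp.leaf)

text \<open>The statement carried by the induction: prescribing colours near the root bag allows a
  branch to be coloured after the part above it.\<close>

definition extendable ::
    "('a \<Rightarrow> 'a \<Rightarrow> ennreal) \<Rightarrow> nat \<Rightarrow> nat \<Rightarrow> nat \<Rightarrow> 'a set \<Rightarrow> 'a set \<Rightarrow> bool" where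
  "extendable d r R D A V \<longleftrightarrow>
     (\<forall>p. \<exists>c. (\<forall>v\<in>V. near d R A v \<longrightarrow> c v = p v) \<and> mono_bounded d V c r D)"

lemma near_mono:
  assumes "near d m A x" "m \<le> n" "A \<subseteq> B"
  shows "near d n B x"
  using assms(1,3) dist_le_mono[OF _ assms(2), of d x] by (auto simp: near_def)

lemma extendable_mono:
  assumes "extendable d r R D B V" "R' \<le> R" "A \<subseteq> B"
  shows "extendable d r R' D A V"
  unfolding extendable_def
proof
  fix p
  obtain c where c: "\<forall>v\<in>V. near d R B v \<longrightarrow> c v = p v" "mono_bounded d V c r D"
    using assms(1) unfolding extendable_def by metis
  then have "\<forall>v\<in>V. near d R' A v \<longrightarrow> c v = p v"
    using near_mono[OF _ assms(2,3)] by simp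
  with c(2) show "\<exists>c. (\<forall>v\<in>V. near d R' A v \<longrightarrow> c v = p v) \<and> mono_bounded d V c r D"
    by blast
qed

section \<open>Cutting branches off the top part\<close>

definition branch ::
    "('a \<Rightarrow> 'a \<Rightarrow> ennreal) \<Rightarrow> 'a set \<Rightarrow> nat \<Rightarrow> 'a set \<Rightarrow> 'a set \<times> 'a set \<Rightarrow> bool" where
  "branch d H k V = (\<lambda>(A, W). finite A \<and> card A \<le> k \<and> A \<subseteq> V \<and> W \<inter> V \<subseteq> A \<and> W \<subseteq> H \<and> gated d H A W)"

text \<open>The second conjunct makes the branch of a point outside \<open>V\<close> unique, which
  is what \<open>owner\<close> relies on.\<close>

definition branching ::
    "('a \<Rightarrow> 'a \<Rightarrow> ennreal) \<Rightarrow> 'a set \<Rightarrow> nat \<Rightarrow> 'a set \<Rightarrow> ('a set \<times> 'a set) set \<Rightarrow> bool" where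
  "branching d H k V F \<longleftrightarrow>
     (\<forall>f\<in>F. branch d H k V f) \<and> (\<forall>f\<in>F. \<forall>g\<in>F. f \<noteq> g \<longrightarrow> snd f \<inter> snd g \<subseteq> V)"

text \<open>\<open>V1\<close> is covered by the top bags, and \<open>F\<close> lists the adhesion set and the point set of each branch
  that was cut off.  The removed points leave the ambient set because the top sets need not be
  gated against them.\<close>

definition prunable ::
    "('a \<Rightarrow> 'a \<Rightarrow> ennreal) \<Rightarrow> 'a set \<Rightarrow> nat \<Rightarrow> ('a set \<Rightarrow> 'a set \<Rightarrow> bool) \<Rightarrow> 'a set \<Rightarrow> 'a set \<Rightarrow> bool" where
  "prunable d H k Q X V \<longleftrightarrow> (\<forall>Z. card (X - Z) \<le> k \<longrightarrow> (\<exists>V1 F.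
     rooted_decomp d (\<lambda>B. finite B \<and> card (B - Z) \<le> k) (H - (V - V1)) X V1 \<and>
     V = V1 \<union> \<Union>(snd ` F) \<and> branching d H (Suc k) V1 F \<and>
     (\<forall>(A, W)\<in>F. A \<inter> Z = {} \<and> Q A W)))"

text \<open>By \<open>cap\<close>, a branch of one side meets the other side only inside both tops,
  so its intersection with the joint top is still contained in its adhesion set.\<close>

lemma branching_Un:
  assumes F: "branching d H k V1 F" "V = V1 \<union> \<Union>(snd ` F)"
    and G: "branching d H k W1 G" "W = W1 \<union> \<Union>(snd ` G)"
    and cap: "V \<inter> W \<subseteq> V1 \<inter> W1"
  shows "branching d H k (V1 \<union> W1) (F \<union> G)"
  unfolding branching_def
proof (intro conjI ballI impI)
  have V: "V1 \<subseteq> V" "\<And>f. f \<in> F \<Longrightarrow> snd f \<subseteq> V" and W: "W1 \<subseteq> W" "\<And>f. f \<in> G \<Longrightarrow> snd f \<subseteq> W"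
    using F(2) G(2) by auto
  fix f
  assume f: "f \<in> F \<union> G"
  obtain A U where fAU: "f = (A, U)" by fastforce
  have "f \<in> F \<Longrightarrow> U \<inter> W1 \<subseteq> V1" "f \<in> G \<Longrightarrow> U \<inter> V1 \<subseteq> W1"
    using V(1) V(2)[of f] W(1) W(2)[of f] cap by (auto simp: fAU)
  moreover have "f \<in> F \<Longrightarrow> branch d H k V1 f" "f \<in> G \<Longrightarrow> branch d H k W1 f"
    using F(1) G(1) by (auto simp: branching_def)
  ultimately show "branch d H k (V1 \<union> W1) f"
    using f unfolding branch_def fAU prod.case by blast
  fix g
  assume g: "g \<in> F \<union> G" "f \<noteq> g"
  have "f \<in> F \<Longrightarrow> g \<in> F \<Longrightarrow> snd f \<inter> snd g \<subseteq> V1" "f \<in> G \<Longrightarrow> g \<in> G \<Longrightarrow> snd f \<inter> snd g \<subseteq> W1"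
    using F(1) G(1) g(2) by (auto simp: branching_def)
  moreover have "snd f \<inter> snd g \<subseteq> V1" if "f \<in> F" "g \<in> G \<or> g \<in> F" "g \<notin> F"
    using V(2)[of f] W(2)[of g] that cap by auto
  moreover have "snd f \<inter> snd g \<subseteq> V1" if "g \<in> F" "f \<in> G"
    using V(2)[of g] W(2)[of f] that cap by auto
  ultimately show "snd f \<inter> snd g \<subseteq> V1 \<union> W1"
    using f g(1) by blast
qed

text \<open>A child whose root bag \<open>Y\<close> has at most \<open>k\<close> points outside
  \<open>Z\<close> joins the top. Otherwise \<open>Y\<close> misses \<open>Z\<close>, and all of
  \<open>W\<close> becomes one branch with adhesion set \<open>X \<inter> Y\<close>;
  \<open>Q\<close> for it follows from its own prunability. \<open>Z\<close> is quantified inside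
  \<open>prunable\<close> because every branch is later pruned for a set of its own.\<close>

lemma rooted_decomp_prunable:
  assumes "rooted_decomp d (\<lambda>B. finite B \<and> card B \<le> Suc k) H X V" "V \<subseteq> H"
    and Q: "\<And>X V. rooted_decomp d (\<lambda>B. finite B \<and> card B \<le> Suc k) H X V \<Longrightarrow> V \<subseteq> H \<Longrightarrow>
      prunable d H k Q X V \<Longrightarrow> Q X V"
    and Q_mono: "\<And>A B W. Q B W \<Longrightarrow> A \<subseteq> B \<Longrightarrow> Q A W"
  shows "prunable d H k Q X V"
  using assms(1,2)
proof (induction rule: rooted_decomp.induct)
  case (leaf X)
  show ?case
    unfolding prunable_def
  proof (intro allI impI exI conjI)
    show "rooted_decomp d (\<lambda>B. finite B \<and> card (B - Z) \<le> k) (H - (X - X)) X X"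
      if "card (X - Z) \<le> k" for Z
      using that leaf by (auto intro: rooted_decomp.leaf)
    show "X = X \<union> \<Union>(snd ` {})" by simp
  qed (auto simp: branching_def)
next
  case (glue X V Y W)
  have VW: "V \<subseteq> H" "W \<subseteq> H" using glue.prems by auto
  have Y: "Y \<subseteq> W" "finite Y" "card Y \<le> Suc k"
    using rooted_decomp_root[OF glue.hyps(2)] by auto
  have cap: "V \<inter> W \<subseteq> X" "V \<inter> W \<subseteq> Y"
    using glue.hyps(3) by auto
  show ?case
    unfolding prunable_def
  proof (intro allI impI)
    fix Z
    assume Z: "card (X - Z) \<le> k"
    let ?P = "\<lambda>B. finite B \<and> card (B - Z) \<le> k"
    obtain V1 F where F: "rooted_decomp d ?P (H - (V - V1)) X V1"
      "V = V1 \<union> \<Union>(snd ` F)" "branching d H (Suc k) V1 F" "\<forall>(A, W)\<in>F. A \<inter> Z = {} \<and> Q A W"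
      using glue.IH(1)[OF VW(1)] Z unfolding prunable_def by blast
    have X: "X \<subseteq> V1" and V1: "V1 \<subseteq> V"
      using rooted_decomp_root[OF F(1)] F(2) by auto
    show "\<exists>V1 F. rooted_decomp d ?P (H - (V \<union> W - V1)) X V1 \<and>
       V \<union> W = V1 \<union> \<Union>(snd ` F) \<and> branching d H (Suc k) V1 F \<and>
       (\<forall>(A, W)\<in>F. A \<inter> Z = {} \<and> Q A W)"
    proof (cases "card (Y - Z) \<le> k")
      case True
      then obtain W1 G where G: "rooted_decomp d ?P (H - (W - W1)) Y W1"
        "W = W1 \<union> \<Union>(snd ` G)" "branching d H (Suc k) W1 G" "\<forall>(A, W)\<in>G. A \<inter> Z = {} \<and> Q A W"
        using glue.IH(2)[OF VW(2)] unfolding prunable_def by blast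
      have YW1: "Y \<subseteq> W1" and W1: "W1 \<subseteq> W"
        using rooted_decomp_root[OF G(1)] G(2) by auto
      have "rooted_decomp d ?P (H - (V \<union> W - (V1 \<union> W1))) X (V1 \<union> W1)"
      proof (rule rooted_decomp.glue)
        show "rooted_decomp d ?P (H - (V \<union> W - (V1 \<union> W1))) X V1"
          by (rule rooted_decomp_antimono[OF F(1)]) (use X W1 cap in blast)
        show "rooted_decomp d ?P (H - (V \<union> W - (V1 \<union> W1))) Y W1"
          by (rule rooted_decomp_antimono[OF G(1)]) (use YW1 V1 cap in blast)
        show "V1 \<inter> W1 \<subseteq> X \<inter> Y"
          using V1 W1 cap by blast
        show "gated d (H - (V \<union> W - (V1 \<union> W1))) (X \<inter> Y) W1"
          unfolding gated_def
        proof (intro ballI impI)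
          fix u v
          assume u: "u \<in> W1" and v: "v \<in> H - (V \<union> W - (V1 \<union> W1)) - W1" and fin: "d u v < top"
          \<comment> \<open>A point of \<open>W\<close> still in the ambient set lies in
            \<open>V1\<close> or \<open>W1\<close>, and by \<open>cap\<close> then in
            \<open>W1\<close>. This is why the removed points leave the ambient set.\<close>
          have "u \<in> W" "v \<in> H - W"
            using u v V1 W1 YW1 cap by auto
          then show "\<exists>z\<in>X \<inter> Y. d u z + d z v \<le> d u v"
            using glue.hyps(4) fin unfolding gated_def by blast
        qed
      qed
      moreover have "branching d H (Suc k) (V1 \<union> W1) (F \<union> G)"
        using branching_Un[OF F(3,2) G(3,2)] X YW1 cap by blast
      moreover have "V \<union> W = V1 \<union> W1 \<union> \<Union>(snd ` (F \<union> G))"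
        using F(2) G(2) by auto
      moreover have "\<forall>(A, W)\<in>F \<union> G. A \<inter> Z = {} \<and> Q A W"
        using F(4) G(4) by blast
      ultimately show ?thesis by blast
    next
      case False
      have "Y \<inter> Z = {}"
      proof (rule ccontr)
        assume "Y \<inter> Z \<noteq> {}"
        then have "card (Y - Z) < card Y"
          using Y(2) by (intro psubset_card_mono) auto
        with False Y(3) show False by simp
      qed
      have "Q (X \<inter> Y) W"
        using Q[OF glue.hyps(2) VW(2) glue.IH(2)[OF VW(2)]] Q_mono by blast
      have "card (X \<inter> Y) \<le> Suc k"
        using Y card_mono[of Y "X \<inter> Y"] by simp
      \<comment> \<open>The branch is first regarded as hanging from its adhesion set alone, so that
        \<open>branching_Un\<close> can attach it to \<open>V1\<close>.\<close>
      then have "branching d H (Suc k) (X \<inter> Y) {(X \<inter> Y, W)}"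
        using Y VW glue.hyps(4) by (auto simp: branching_def branch_def)
      then have "branching d H (Suc k) (V1 \<union> X \<inter> Y) (F \<union> {(X \<inter> Y, W)})"
        by (rule branching_Un[OF F(3,2)]) (use Y X cap in auto)
      moreover have "V1 \<union> X \<inter> Y = V1"
        using X by auto
      moreover have "rooted_decomp d ?P (H - (V \<union> W - V1)) X V1"
        by (rule rooted_decomp_antimono[OF F(1)]) auto
      moreover have "\<forall>(A, W)\<in>F \<union> {(X \<inter> Y, W)}. A \<inter> Z = {} \<and> Q A W"
        using F(4) \<open>Y \<inter> Z = {}\<close> \<open>Q (X \<inter> Y) W\<close> by auto
      moreover have "V \<union> W = V1 \<union> \<Union>(snd ` (F \<union> {(X \<inter> Y, W)}))"
        using F(2) by auto
      ultimately show ?thesis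
        by (intro exI[of _ V1] exI[of _ "F \<union> {(X \<inter> Y, W)}"]) simp
    qed
  qed
qed

section \<open>Combining the colourings\<close>

definition boundary_colour ::
    "('a \<Rightarrow> 'a \<Rightarrow> ennreal) \<Rightarrow> nat \<Rightarrow> ('a \<Rightarrow> bool) \<Rightarrow> 'a set \<Rightarrow> 'a \<Rightarrow> bool" where
  "boundary_colour d r c A w \<longleftrightarrow>
     (if near d r A w then c (SOME a. a \<in> A \<and> dist_le d r w a) else near d (2 * r) A w)"

text \<open>The top colouring \<open>c0\<close> is bounded for the step \<open>E + 3 * r\<close>,
  the cost of replacing an excursion: \<open>r\<close> to enter a fringe, \<open>E\<close> inside
  it, \<open>r\<close> to leave it and \<open>r\<close> to the next anchor in
  \<open>V\<close>.\<close>

locale coloured_branching =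
  fixes d :: "'a \<Rightarrow> 'a \<Rightarrow> ennreal" and H :: "'a set" and r k :: nat and V :: "'a set"
    and F :: "('a set \<times> 'a set) set" and c0 :: "'a \<Rightarrow> bool"
    and cB :: "'a set \<times> 'a set \<Rightarrow> 'a \<Rightarrow> bool" and D D0 :: nat
  assumes d: "pseudometric d" and VH: "V \<subseteq> H" and F: "branching d H k V F"
    and boundary: "\<And>A W w. (A, W) \<in> F \<Longrightarrow> w \<in> W \<Longrightarrow> near d (3 * r) A w \<Longrightarrow>
      cB (A, W) w = boundary_colour d r c0 A w"
    and cB: "\<And>A W. (A, W) \<in> F \<Longrightarrow> mono_bounded d W (cB (A, W)) r D"
    and c0: "mono_bounded d V c0 (absorbed_bound r (2 * r) 0 k + 3 * r) D0"
begin

abbreviation "E \<equiv> absorbed_bound r (2 * r) 0 k"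

definition "owner w = (SOME f. f \<in> F \<and> w \<in> snd f)"

definition "colour w = (if w \<in> V then c0 w else cB (owner w) w)"

definition "fringe f = {w \<in> snd f - V. near d (2 * r) (fst f) w}"

text \<open>\<open>V\<close> with the first two layers of every branch: no monochromatic step
  crosses its border, so walks inside and outside are treated separately.\<close>

definition "core = V \<union> \<Union>(fringe ` F)"

lemma owner_eq:
  assumes "f \<in> F" "w \<in> snd f" "w \<notin> V"
  shows "owner w = f"
proof -
  have "g = f" if "g \<in> F \<and> w \<in> snd g" for g
    using F assms that unfolding branching_def by blast
  then show ?thesis
    unfolding owner_def using assms(1,2) by (intro some_equality) blast+
qed

lemma branchD:
  assumes "(A, W) \<in> F"
  shows "finite A" "card A \<le> k" "A \<subseteq> V" "W \<inter> V \<subseteq> A" "W \<subseteq> H" "gated d H A W"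
  using F assms by (auto simp: branching_def branch_def)

lemma colour_branch: "(A, W) \<in> F \<Longrightarrow> w \<in> W \<Longrightarrow> w \<notin> V \<Longrightarrow> colour w = cB (A, W) w"
  using owner_eq[of "(A, W)" w] by (simp add: colour_def)

text \<open>Either \<open>y\<close> lies in \<open>W\<close> and \<open>V\<close>, hence in
  \<open>A\<close>, or a gate in \<open>A\<close> lies between \<open>w\<close> and
  \<open>y\<close>.\<close>

lemma branch_leave_near:
  assumes AW: "(A, W) \<in> F" and w: "w \<in> W" and y: "y \<in> V \<union> \<Union>(snd ` F)" "y \<notin> W - V"
    and wy: "dist_le d r w y"
  shows "near d r A w"
proof (cases "y \<in> W")
  case True
  then show ?thesis
    using y branchD(4)[OF AW] wy by (auto simp: near_def)
next
  case False
  have "y \<in> H"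
    using y(1) VH branchD(5) by (auto simp: subset_iff)
  have "d w y < top"
    using wy unfolding dist_le_def by (rule le_less_trans) (rule of_nat_less_top)
  then obtain z where z: "z \<in> A" "d w z + d z y \<le> d w y"
    using branchD(6)[OF AW] w False \<open>y \<in> H\<close> unfolding gated_def by blast
  have "d w z \<le> d w z + d z y"
    by simp
  also have "\<dots> \<le> of_nat r"
    using z(2) wy unfolding dist_le_def by (rule order_trans)
  finally have "d w z \<le> of_nat r" .
  then show ?thesis
    using z(1) by (auto simp: near_def dist_le_def)
qed

text \<open>The first layer copies the colour of a chosen adhesion point, so this point can replace
  \<open>w\<close> in a monochromatic walk inside \<open>V\<close>.\<close>

lemma near_anchor:
  assumes AW: "(A, W) \<in> F" and w: "w \<in> W" "w \<notin> V" and near: "near d r A w"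
  obtains a where "a \<in> V" "dist_le d r w a" "c0 a = colour w"
proof -
  let ?a = "SOME a. a \<in> A \<and> dist_le d r w a"
  have a: "?a \<in> A \<and> dist_le d r w ?a"
    using near someI_ex[of "\<lambda>a. a \<in> A \<and> dist_le d r w a"] unfolding near_def by blast
  have "near d (3 * r) A w"
    using near by (rule near_mono) auto
  then have "colour w = c0 ?a"
    using boundary[OF AW w(1)] near colour_branch[OF AW w] by (simp add: boundary_colour_def)
  then show thesis
    using that a branchD(3)[OF AW] by auto
qed

text \<open>A fringe is covered by at most \<open>k\<close> balls of radius \<open>2 * r\<close>, so
  starting from the empty set, with bound 0, absorption gives \<open>E\<close> for any
  colouring.\<close>

lemma fringe_bounded: "f \<in> F \<Longrightarrow> mono_bounded d (fringe f) colour r E"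
proof -
  assume f: "f \<in> F"
  obtain A W where AW: "f = (A, W)" by fastforce
  have "\<And>x y. (mono_step d {} colour r)\<^sup>*\<^sup>* x y \<Longrightarrow> x = y"
    by (erule rtranclp.cases) (auto simp: mono_step_def)
  then have "mono_bounded d {} colour r 0"
    using dist_le_refl[OF d] by (metis mono_bounded_def)
  moreover have "{x \<in> fringe f. \<not> near d (2 * r) A x} = {}"
    by (auto simp: fringe_def AW)
  ultimately have "mono_bounded d {x \<in> fringe f. \<not> near d (2 * r) A x} colour r 0"
    by (simp only:)
  then show ?thesis
    using mono_bounded_absorb[OF d] branchD(1,2)[of A W] f AW by blast
qed

text \<open>The boundary colouring is \<open>True\<close> at distance between \<open>r\<close> and \<open>2 * r\<close> from the adhesion
  set, and \<open>False\<close> between \<open>2 * r\<close> and \<open>3 * r\<close>: no step can cross this barrier.\<close>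

lemma core_step:
  assumes step: "mono_step d (V \<union> \<Union>(snd ` F)) colour r x y" and x: "x \<in> core"
  shows "y \<in> core"
proof (rule ccontr)
  assume y: "y \<notin> core"
  then have "y \<notin> V" by (simp add: core_def)
  then obtain A W where AW: "(A, W) \<in> F" "y \<in> W"
    using step by (auto simp: mono_step_def)
  have far: "\<not> near d (2 * r) A y"
    using y AW \<open>y \<notin> V\<close> by (force simp: core_def fringe_def)
  have yx: "dist_le d r y x" and xy: "dist_le d r x y" and xS: "x \<in> V \<union> \<Union>(snd ` F)"
    and col: "colour x = colour y"
    using step dist_le_sym[OF d] by (auto simp: mono_step_def)
  have far1: "\<not> near d r A y"
    using far near_mono[of d r A y "2 * r" A] by auto
  have xW: "x \<in> W" "x \<notin> V"
    using branch_leave_near[OF AW xS _ yx] far1 by auto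
  then obtain f where "f \<in> F" "x \<in> fringe f"
    using x by (auto simp: core_def)
  then have "f = (A, W)"
    using owner_eq[of f x] owner_eq[of "(A, W)" x] xW AW by (auto simp: fringe_def)
  then have x2: "near d (2 * r) A x"
    using \<open>x \<in> fringe f\<close> by (simp add: fringe_def)
  then obtain a where a: "a \<in> A" "dist_le d (2 * r) x a"
    by (auto simp: near_def)
  have "near d (3 * r) A y"
    using a dist_le_trans[OF d yx a(2), of "3 * r"] by (auto simp: near_def)
  \<comment> \<open>\<open>y\<close> lies in the third layer and \<open>x\<close>, by what follows,
    in the second, so their colours differ.\<close>
  then have "\<not> colour y"
    using boundary[OF AW] far far1 colour_branch[OF AW \<open>y \<notin> V\<close>] by (simp add: boundary_colour_def)
  moreover have "\<not> near d r A x"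
  proof
    assume "near d r A x"
    then obtain b where "b \<in> A" "dist_le d r x b"
      by (auto simp: near_def)
    then have "near d (2 * r) A y"
      using dist_le_trans[OF d yx, of r b "2 * r"] by (auto simp: near_def)
    with far show False by simp
  qed
  moreover have "near d (3 * r) A x"
    using x2 by (rule near_mono) auto
  ultimately show False
    using boundary[OF AW(1) xW(1)] x2 colour_branch[OF AW(1) xW] col by (simp add: boundary_colour_def)
qed

text \<open>Outside the core a point of a branch is further than \<open>2 * r\<close> from the
  adhesion set, so by \<open>branch_leave_near\<close> no step leaves the branch;
  \<open>core_step\<close>, applied to reversed steps, keeps the walk out of the core.\<close>

lemma far_walk:
  assumes "(mono_step d (V \<union> \<Union>(snd ` F)) colour r)\<^sup>*\<^sup>* x y" "x \<notin> core"
    and AW: "(A, W) \<in> F" "x \<in> W"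
  shows "(mono_step d W (cB (A, W)) r)\<^sup>*\<^sup>* x y \<and> y \<in> W \<and> y \<notin> core"
  using assms(1)
proof (induction rule: rtranclp_induct)
  case (step y z)
  then have y: "y \<in> W" "y \<notin> core" "y \<notin> V"
    by (auto simp: core_def)
  have yz: "dist_le d r y z" "z \<in> V \<union> \<Union>(snd ` F)" "colour y = colour z"
    using step.hyps by (auto simp: mono_step_def)
  have "mono_step d (V \<union> \<Union>(snd ` F)) colour r z y"
    using step.hyps dist_le_sym[OF d] by (simp add: mono_step_def)
  then have z: "z \<notin> core" "z \<notin> V"
    using core_step y by (auto simp: core_def)
  have "\<not> near d r A y"
    using y AW near_mono[of d r A y "2 * r" A] by (force simp: core_def fringe_def)
  then have "z \<in> W"
    using branch_leave_near[OF AW(1) y(1) yz(2) _ yz(1)] by auto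
  then have "mono_step d W (cB (A, W)) r y z"
    using y z yz colour_branch[OF AW(1)] by (simp add: mono_step_def)
  then show ?case
    using step.IH z \<open>z \<in> W\<close> rtranclp.rtrancl_into_rtrancl[of _ x y z] by blast
qed (use assms in auto)

text \<open>The state of a walk relative to \<open>V\<close>: \<open>a\<close> is its current
  anchor, and \<open>y\<close> is reached from it inside a single fringe, entered at
  \<open>e\<close>.\<close>

definition "attached a y \<longleftrightarrow> y = a \<or> (\<exists>f\<in>F. y \<in> fringe f \<and>
  (\<exists>e. dist_le d r a e \<and> c0 a = colour e \<and> (mono_step d (fringe f) colour r)\<^sup>*\<^sup>* e y))"

lemma attachedD:
  assumes "attached a y" "a \<in> V"
  shows "dist_le d (r + E) a y" "c0 a = colour y"
proof -
  have "dist_le d (r + E) a y \<and> c0 a = colour y"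
  proof (cases "y = a")
    case True
    then show ?thesis
      using assms(2) dist_le_refl[OF d] by (simp add: colour_def)
  next
    case False
    then obtain f e where "f \<in> F" "dist_le d r a e" "c0 a = colour e"
      "(mono_step d (fringe f) colour r)\<^sup>*\<^sup>* e y"
      using assms(1) by (auto simp: attached_def)
    then have "dist_le d r a e" "dist_le d E e y" "c0 a = colour y"
      using mono_step_rtranclp_colour[of d "fringe f" colour r e y] fringe_bounded[of f]
      by (simp_all add: mono_bounded_def)
    then show ?thesis
      using dist_le_trans[OF d _ _ order_refl] by blast
  qed
  then show "dist_le d (r + E) a y" "c0 a = colour y" by auto
qed

text \<open>If \<open>z\<close> is in a fringe and \<open>y\<close> is not in the same one, then
  \<open>y\<close> is outside that branch or in \<open>V\<close>. Hence \<open>z\<close> is in the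
  first layer and has an anchor of its colour.\<close>

lemma hop:
  assumes step: "mono_step d core colour r y z" and no: "\<And>f. f \<in> F \<Longrightarrow> \<not> (y \<in> fringe f \<and> z \<in> fringe f)"
  obtains b where "b \<in> V" "dist_le d r z b" "c0 b = colour z" "attached b z"
proof (cases "z \<in> V")
  case True
  then show thesis
    using that[of z] dist_le_refl[OF d] by (simp add: attached_def colour_def)
next
  case False
  then obtain f where f: "f \<in> F" "z \<in> fringe f"
    using step by (auto simp: mono_step_def core_def)
  obtain A W where AW: "f = (A, W)" by fastforce
  have y: "y \<in> core" "dist_le d r z y"
    using step dist_le_sym[OF d] by (auto simp: mono_step_def)
  have "y \<notin> W - V"
  proof
    assume yW: "y \<in> W - V"
    then obtain g where g: "g \<in> F" "y \<in> fringe g"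
      using y by (auto simp: core_def)
    then have "g = f"
      using owner_eq[of g y] owner_eq[of f y] yW f AW by (auto simp: fringe_def)
    with no[OF f(1)] f g show False by simp
  qed
  moreover have "y \<in> V \<union> \<Union>(snd ` F)"
    using y(1) by (auto simp: core_def fringe_def)
  ultimately have "near d r A z"
    using branch_leave_near[of A W z y] f AW y(2) by (auto simp: fringe_def)
  then obtain b where b: "b \<in> V" "dist_le d r z b" "c0 b = colour z"
    using near_anchor[of A W z] f AW by (auto simp: fringe_def)
  moreover have "attached b z"
    using b f dist_le_sym[OF d b(2)] unfolding attached_def by blast
  ultimately show thesis by (rule that)
qed

lemma fringe_inj: "f \<in> F \<Longrightarrow> g \<in> F \<Longrightarrow> y \<in> fringe f \<Longrightarrow> y \<in> fringe g \<Longrightarrow> f = g"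
  using owner_eq[of f y] owner_eq[of g y] by (auto simp: fringe_def)

text \<open>An excursion into a fringe leaves and re-enters \<open>V\<close> near points of its own colour, so it
  can be replaced by a single longer step inside \<open>V\<close>.\<close>

lemma core_walk:
  assumes "(mono_step d core colour r)\<^sup>*\<^sup>* x y" "x \<in> core"
  shows "(\<exists>f\<in>F. (mono_step d (fringe f) colour r)\<^sup>*\<^sup>* x y \<and> y \<in> fringe f) \<or>
    (\<exists>x'\<in>V. \<exists>a\<in>V. dist_le d (E + 2 * r) x x' \<and>
      (mono_step d V c0 (E + 3 * r))\<^sup>*\<^sup>* x' a \<and> attached a y)"
  using assms(1)
proof (induction rule: rtranclp_induct)
  case base
  then show ?case
    using assms(2) dist_le_refl[OF d] unfolding core_def attached_def by blast
next
  case (step y z)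
  have yz: "dist_le d r y z" "colour y = colour z"
    using step.hyps by (auto simp: mono_step_def)
  consider (fringe) f where "f \<in> F" "(mono_step d (fringe f) colour r)\<^sup>*\<^sup>* x y" "y \<in> fringe f"
    | (walk) x' a where "x' \<in> V" "a \<in> V" "dist_le d (E + 2 * r) x x'"
      "(mono_step d V c0 (E + 3 * r))\<^sup>*\<^sup>* x' a" "attached a y"
    using step.IH by blast
  note cases = this
  show ?case
  \<comment> \<open>A step inside one fringe keeps the current anchor; any other step moves to a new
    anchor \<open>b\<close>. The first alternative of the claim means that the starting fringe has
    not been left yet.\<close>
  proof (cases "\<exists>f\<in>F. y \<in> fringe f \<and> z \<in> fringe f")
    case True
    then obtain g where g: "g \<in> F" "y \<in> fringe g" "z \<in> fringe g" by blast
    then have s: "mono_step d (fringe g) colour r y z"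
      using yz by (simp add: mono_step_def)
    show ?thesis
      using cases
    proof cases
      case (fringe f)
      then have "f = g" using fringe_inj g by blast
      then show ?thesis
        using fringe g s
          rtranclp.rtrancl_into_rtrancl[of "mono_step d (fringe g) colour r" x y z] by blast
    next
      case (walk x' a)
      have "y \<noteq> a"
        using walk g by (auto simp: fringe_def)
      then obtain f e where e: "f \<in> F" "y \<in> fringe f" "dist_le d r a e" "c0 a = colour e"
        "(mono_step d (fringe f) colour r)\<^sup>*\<^sup>* e y"
        using walk(5) unfolding attached_def by blast
      then have "f = g" using fringe_inj g by blast
      then have "attached a z"
        using e g s
          rtranclp.rtrancl_into_rtrancl[of "mono_step d (fringe g) colour r" e y z]
        unfolding attached_def by blast
      then show ?thesis using walk by blast
    qed
  next
    case False
    then obtain b where b: "b \<in> V" "dist_le d r z b" "c0 b = colour z" "attached b z"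
      using hop[OF step.hyps(2)] by blast
    have yb: "dist_le d (2 * r) y b"
      using dist_le_trans[OF d yz(1) b(2)] by simp
    show ?thesis
      using cases
    proof cases
      case (fringe f)
      then have "dist_le d E x y"
        using fringe_bounded by (auto simp: mono_bounded_def)
      then have "dist_le d (E + 2 * r) x b"
        by (rule dist_le_trans[OF d _ yb order_refl])
      then show ?thesis
        using b by blast
    next
      case (walk x' a)
      \<comment> \<open>At most \<open>r + E\<close> from \<open>a\<close> to \<open>y\<close> and
        \<open>2 * r\<close> from \<open>y\<close> to \<open>b\<close>.\<close>
      have "dist_le d (E + 3 * r) a b"
        using dist_le_trans[OF d attachedD(1)[OF walk(5,2)] yb, of "E + 3 * r"] by simp
      then have "mono_step d V c0 (E + 3 * r) a b"
        using walk b attachedD(2)[OF walk(5,2)] yz by (simp add: mono_step_def)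
      then have "(mono_step d V c0 (E + 3 * r))\<^sup>*\<^sup>* x' b"
        using walk(4) by (rule rtranclp.rtrancl_into_rtrancl[rotated])
      then show ?thesis
        using walk b by blast
    qed
  qed
qed

text \<open>Outside the core the bound \<open>D\<close> of a branch applies. Inside, the distances
  add up to \<open>E + 2 * r\<close> from \<open>x\<close> to the first anchor, \<open>D0\<close>
  between anchors and \<open>r + E\<close> from the last anchor to \<open>y\<close>.\<close>

lemma colour_bounded:
  "mono_bounded d (V \<union> \<Union>(snd ` F)) colour r (max D (D0 + 2 * E + 3 * r))"
  unfolding mono_bounded_def
proof (intro allI impI)
  fix x y
  let ?S = "V \<union> \<Union>(snd ` F)"
  assume xy: "(mono_step d ?S colour r)\<^sup>*\<^sup>* x y"
  show "dist_le d (max D (D0 + 2 * E + 3 * r)) x y"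
  proof (cases "x = y")
    case True
    then show ?thesis using dist_le_refl[OF d] by simp
  next
    case False
    then have "x \<in> ?S"
      using xy by (auto elim: converse_rtranclpE simp: mono_step_def)
    show ?thesis
    proof (cases "x \<in> core")
      case True
      have "(mono_step d core colour r)\<^sup>*\<^sup>* x y \<and> y \<in> core"
        using xy
      proof (induction rule: rtranclp_induct)
        case (step y z)
        then have "mono_step d core colour r y z \<and> z \<in> core"
          using core_step by (auto simp: mono_step_def)
        then show ?case
          using step.IH rtranclp.rtrancl_into_rtrancl[of _ x y z] by blast
      qed (use True in simp)
      then consider (fringe) f where "f \<in> F" "(mono_step d (fringe f) colour r)\<^sup>*\<^sup>* x y"
        | (walk) x' a where "x' \<in> V" "a \<in> V" "dist_le d (E + 2 * r) x x'"
          "(mono_step d V c0 (E + 3 * r))\<^sup>*\<^sup>* x' a" "attached a y"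
        using core_walk[OF _ True] by blast
      then have "dist_le d (D0 + 2 * E + 3 * r) x y"
      proof cases
        case (fringe f)
        then have "dist_le d E x y"
          using fringe_bounded by (auto simp: mono_bounded_def)
        then show ?thesis by (rule dist_le_mono) simp
      next
        case (walk x' a)
        then have "dist_le d D0 x' a"
          using c0 by (simp add: mono_bounded_def)
        then have "dist_le d (E + 2 * r + D0) x a"
          by (rule dist_le_trans[OF d walk(3) _ order_refl])
        then show ?thesis
          by (rule dist_le_trans[OF d _ attachedD(1)[OF walk(5,2)]]) simp
      qed
      then show ?thesis by (rule dist_le_mono) simp
    next
      case False
      then obtain A W where AW: "(A, W) \<in> F" "x \<in> W"
        using \<open>x \<in> ?S\<close> by (auto simp: core_def)
      then have "dist_le d D x y"
        using far_walk[OF xy False AW] cB[OF AW(1)] by (simp add: mono_bounded_def)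
      then show ?thesis by (rule dist_le_mono) simp
    qed
  qed
qed

end

section \<open>The induction on the bag size\<close>

text \<open>A step starting further than \<open>R + r\<close> from \<open>X\<close> has no shortcut
  through \<open>Z\<close>, since that would put its start within \<open>r\<close> of
  \<open>Z\<close>. Such steps survive the deletion, and the points nearer to \<open>X\<close> are
  absorbed.\<close>

lemma mono_bounded_deletion:
  assumes d: "pseudometric d" and Z: "Z = {v. near d R X v}" and X: "finite X" "card X \<le> k"
    and c: "mono_bounded (path_metric (deletion_weight d Z V)) (V - Z) c r D"
    and c0: "\<And>v. v \<notin> Z \<Longrightarrow> c0 v = c v"
  shows "mono_bounded d V c0 r (absorbed_bound r (R + r) D k)"
proof (rule mono_bounded_absorb[OF d X])
  let ?w = "deletion_weight d Z V"
  let ?T = "{x \<in> V. \<not> near d (R + r) X x}"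
  show "mono_bounded d ?T c0 r D"
    unfolding mono_bounded_def
  proof (intro allI impI)
    fix x y
    assume xy: "(mono_step d ?T c0 r)\<^sup>*\<^sup>* x y"
    have "(mono_step (path_metric ?w) (V - Z) c r)\<^sup>*\<^sup>* x y"
      using xy
    proof (rule mono_step_rtranclp_mono)
      fix x y
      assume "mono_step d ?T c0 r x y"
      then have xT: "x \<in> V" "\<not> near d (R + r) X x" and yT: "y \<in> V" "\<not> near d (R + r) X y"
        and col: "c0 x = c0 y" and r: "dist_le d r x y"
        by (auto simp: mono_step_def)
      have xZ: "x \<notin> Z" "y \<notin> Z"
        using xT yT near_mono[of d R X _ "R + r" X] by (auto simp: Z)
      have "\<not> d x z + d z y \<le> d x y" if zZ: "z \<in> Z" for z
      proof
        assume "d x z + d z y \<le> d x y"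
        then have "d x z + d z y \<le> of_nat r"
          using r unfolding dist_le_def by (rule order_trans)
        moreover have "d x z \<le> d x z + d z y"
          by simp
        ultimately have "dist_le d r x z"
          unfolding dist_le_def by (rule order_trans[rotated])
        moreover obtain a where "a \<in> X" "dist_le d R z a"
          using zZ by (auto simp: Z near_def)
        ultimately have "near d (R + r) X x"
          using dist_le_trans[OF d, of r x z R a "R + r"] by (auto simp: near_def)
        with xT show False by simp
      qed
      then have "?w x y = d x y"
        using xT yT xZ by (simp add: deletion_weight_def)
      then have "dist_le (path_metric ?w) r x y"
        using path_metric_le_weight[of ?w x y] r unfolding dist_le_def by simp
      then show "mono_step (path_metric ?w) (V - Z) c r x y"
        using xT yT xZ col c0 by (simp add: mono_step_def)
    qed
    then have "path_metric ?w x y \<le> of_nat D"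
      using c by (simp add: mono_bounded_def dist_le_def)
    moreover have "d x y \<le> path_metric ?w x y"
      by (rule path_metric_ge[OF d]) (simp add: deletion_weight_def)
    ultimately show "dist_le d D x y"
      unfolding dist_le_def by simp
  qed
qed

text \<open>One \<open>D\<close> serves as the bound for the branches below and for the conclusion.
  It only has to dominate the bound arising in the top part.\<close>

lemma prunable_extendable:
  fixes d :: "'a \<Rightarrow> 'a \<Rightarrow> ennreal" and r k :: nat
  defines "E \<equiv> absorbed_bound r (2 * r) 0 (Suc k)"
  defines "r1 \<equiv> E + 3 * r"
  assumes d: "pseudometric d" and VH: "V \<subseteq> H" and R: "3 * r \<le> R"
    and X: "finite X" "card X \<le> Suc k"
    and IH: "\<And>d H X V. pseudometric d \<Longrightarrow> rooted_decomp d (\<lambda>B. finite B \<and> card B \<le> k) H X V \<Longrightarrow>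
      V \<subseteq> H \<Longrightarrow> extendable (d :: 'a \<Rightarrow> 'a \<Rightarrow> ennreal) r1 0 D1 X V"
    and D: "absorbed_bound r1 (R + r1) D1 (Suc k) + 2 * E + 3 * r \<le> D"
    and prune: "prunable d H k (extendable d r R D) X V"
  shows "extendable d r R D X V"
  unfolding extendable_def
proof
  fix p
  define Z where "Z = {v. near d R X v}"
  have XZ: "X \<subseteq> Z"
    using dist_le_refl[OF d] by (auto simp: Z_def near_def)
  then have "card (X - Z) \<le> k"
    by (simp add: Diff_eq_empty_iff[THEN iffD2])
  then obtain V1 F where top: "rooted_decomp d (\<lambda>B. finite B \<and> card (B - Z) \<le> k) (H - (V - V1)) X V1"
    and V: "V = V1 \<union> \<Union>(snd ` F)" and F: "branching d H (Suc k) V1 F"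
    and below: "\<forall>(A, W)\<in>F. A \<inter> Z = {} \<and> extendable d r R D A W"
    using prune unfolding prunable_def by blast
  let ?d1 = "path_metric (deletion_weight d Z V1)"
  have "rooted_decomp ?d1 (\<lambda>B. finite B \<and> card B \<le> k) (V1 - Z) (X - Z) (V1 - Z)"
    by (rule rooted_decomp_deletion[OF top d]) (use V VH in auto)
  then have "extendable ?d1 r1 0 D1 (X - Z) (V1 - Z)"
    by (rule IH[OF pseudometric_path_metric[of "deletion_weight d Z V1", OF deletion_weight_sym[OF d]]]) simp
  then obtain c1 where c1: "mono_bounded ?d1 (V1 - Z) c1 r1 D1"
    unfolding extendable_def by blast
  define c0 where "c0 v = (if v \<in> Z then p v else c1 v)" for v
  have c0: "mono_bounded d V1 c0 r1 (absorbed_bound r1 (R + r1) D1 (Suc k))"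
    by (rule mono_bounded_deletion[OF d Z_def X c1]) (simp add: c0_def)
  have "\<forall>f\<in>F. \<exists>c. (\<forall>v\<in>snd f. near d R (fst f) v \<longrightarrow> c v = boundary_colour d r c0 (fst f) v) \<and>
      mono_bounded d (snd f) c r D"
    using below unfolding extendable_def by fastforce
  then obtain cB where cB: "\<And>f. f \<in> F \<Longrightarrow>
      (\<forall>v\<in>snd f. near d R (fst f) v \<longrightarrow> cB f v = boundary_colour d r c0 (fst f) v) \<and>
      mono_bounded d (snd f) (cB f) r D"
    by metis
  interpret coloured_branching d H r "Suc k" V1 F c0 cB D "absorbed_bound r1 (R + r1) D1 (Suc k)"
  proof
    show "cB (A, W) w = boundary_colour d r c0 A w"
      if "(A, W) \<in> F" "w \<in> W" "near d (3 * r) A w" for A W w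
      using cB[OF that(1)] that(2) near_mono[OF that(3) R order_refl] by simp
    show "mono_bounded d W (cB (A, W)) r D" if "(A, W) \<in> F" for A W
      using cB[OF that] by simp
  qed (use d F V VH c0 in \<open>auto simp: E_def r1_def\<close>)
  have "colour v = p v" if v: "v \<in> V" "near d R X v" for v
  proof -
    \<comment> \<open>In a branch, a gate between \<open>v\<close> and a point of \<open>X\<close>
      would be within \<open>R\<close> of \<open>X\<close>, hence in \<open>Z\<close>, which the
      adhesion sets avoid.\<close>
    have "v \<in> V1"
    proof (rule ccontr)
      assume "v \<notin> V1"
      then obtain A W where AW: "(A, W) \<in> F" "v \<in> W"
        using v V by auto
      then have AZ: "A \<inter> Z = {}"
        using below by blast
      obtain x where x: "x \<in> X" "dist_le d R v x"
        using v by (auto simp: near_def)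
      have "x \<in> V1"
        using rooted_decomp_root[OF top] x by auto
      have "x \<notin> W"
        using branchD(4)[OF AW(1)] \<open>x \<in> V1\<close> x XZ AZ by blast
      have "d v x < top"
        using x(2) unfolding dist_le_def by (rule le_less_trans) (rule of_nat_less_top)
      then obtain z where z: "z \<in> A" "d v z + d z x \<le> d v x"
        using branchD(6)[OF AW(1)] AW(2) \<open>x \<notin> W\<close> \<open>x \<in> V1\<close> V VH unfolding gated_def by blast
      have "d z x \<le> d v z + d z x"
        by simp
      also have "\<dots> \<le> of_nat R"
        using z(2) x(2) unfolding dist_le_def by (rule order_trans)
      finally have "z \<in> Z"
        using x(1) by (auto simp: Z_def near_def dist_le_def)
      with z(1) AZ show False by auto
    qed
    then show ?thesis
      using v by (simp add: colour_def c0_def Z_def)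
  qed
  \<comment> \<open>The maximum in \<open>colour_bounded\<close> is \<open>D\<close> itself, so
    nesting branches within branches does not worsen the bound.\<close>
  moreover have "mono_bounded d V colour r D"
    using colour_bounded D V by (simp add: E_def max_absorb1)
  ultimately show "\<exists>c. (\<forall>v\<in>V. near d R X v \<longrightarrow> c v = p v) \<and> mono_bounded d V c r D"
    by blast
qed

text \<open>\<open>r\<close> and \<open>R\<close> vary in the induction because smaller bags are
  coloured for the longer step \<open>E + 3 * r\<close>. \<open>D\<close> is chosen before the
  metric and the decomposition.\<close>

lemma rooted_decomp_extendable:
  "\<exists>D. \<forall>d H X V. pseudometric d \<longrightarrow> rooted_decomp d (\<lambda>B. finite B \<and> card B \<le> k) H X V \<longrightarrow>
     V \<subseteq> H \<longrightarrow> extendable (d :: 'a \<Rightarrow> 'a \<Rightarrow> ennreal) r R D X V"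
proof (induction k arbitrary: r R)
  case 0
  have "V = {}" if "rooted_decomp d (\<lambda>B. finite B \<and> card B \<le> 0) H X V"
    for d :: "'a \<Rightarrow> 'a \<Rightarrow> ennreal" and H X V
    using that by (induction rule: rooted_decomp.induct) auto
  moreover have "extendable d r R 0 X {}" if "pseudometric d" for d :: "'a \<Rightarrow> 'a \<Rightarrow> ennreal" and X
  proof -
    have "x = y" if "(mono_step d {} c r)\<^sup>*\<^sup>* x y" for c x y
      using that by (cases rule: rtranclp.cases) (auto simp: mono_step_def)
    then show ?thesis
      using dist_le_refl[OF that] unfolding extendable_def mono_bounded_def by blast
  qed
  ultimately show ?case by blast
next
  case (Suc k)
  \<comment> \<open>The three layers of width \<open>r\<close> have to fit into the precoloured
    neighbourhood.\<close>
  define R' where "R' = max R (3 * r)"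
  define E where "E = absorbed_bound r (2 * r) 0 (Suc k)"
  obtain D1 where D1: "\<And>d H X V. pseudometric d \<Longrightarrow>
      rooted_decomp d (\<lambda>B. finite B \<and> card B \<le> k) H X V \<Longrightarrow> V \<subseteq> H \<Longrightarrow>
      extendable (d :: 'a \<Rightarrow> 'a \<Rightarrow> ennreal) (E + 3 * r) 0 D1 X V"
    using Suc.IH[of "E + 3 * r" 0] by blast
  define D where "D = absorbed_bound (E + 3 * r) (R' + (E + 3 * r)) D1 (Suc k) + 2 * E + 3 * r"
  have "extendable d r R D X V"
    if d: "pseudometric d" and dec: "rooted_decomp d (\<lambda>B. finite B \<and> card B \<le> Suc k) H X V"
      and VH: "V \<subseteq> H"
    for d :: "'a \<Rightarrow> 'a \<Rightarrow> ennreal" and H X V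
  proof -
    \<comment> \<open>Used twice: for the subtrees inside \<open>rooted_decomp_prunable\<close>,
      then for the whole decomposition.\<close>
    have step: "extendable d r R' D X V"
      if "rooted_decomp d (\<lambda>B. finite B \<and> card B \<le> Suc k) H X V" "V \<subseteq> H"
        "prunable d H k (extendable d r R' D) X V" for X V
    proof (rule prunable_extendable[OF d that(2)])
      show "absorbed_bound (absorbed_bound r (2 * r) 0 (Suc k) + 3 * r)
          (R' + (absorbed_bound r (2 * r) 0 (Suc k) + 3 * r)) D1 (Suc k) +
          2 * absorbed_bound r (2 * r) 0 (Suc k) + 3 * r \<le> D"
        by (simp only: D_def E_def)
    qed (use rooted_decomp_root[OF that(1)] that(3) D1 in \<open>auto simp: R'_def E_def\<close>)
    have "prunable d H k (extendable d r R' D) X V"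
      by (rule rooted_decomp_prunable[OF dec VH]) (auto intro: step extendable_mono[OF _ order_refl])
    then have "extendable d r R' D X V"
      using step dec VH by blast
    then show ?thesis
      by (rule extendable_mono) (auto simp: R'_def)
  qed
  then show ?case by blast
qed

section \<open>Tree decompositions as rooted decompositions\<close>

lemma path_edges_append: "path_edges (xs @ y # ys) = path_edges (xs @ [y]) @ path_edges (y # ys)"
proof (induction xs)
  case (Cons x xs)
  then show ?case by (cases xs) auto
qed simp

text \<open>If \<open>z\<close> is already on the path, the path is cut there. The general
  \<open>f\<close> covers edge weights as well as plain connectivity, where it is zero.\<close>

lemma graph_path_extend:
  fixes f :: "'a set \<Rightarrow> ennreal"
  assumes p: "graph_path G u p v" and z: "z \<in> verts G" "{v, z} \<in> edges G"
  obtains q where "graph_path G u q z"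
    "sum_list (map f (path_edges q)) \<le> sum_list (map f (path_edges p)) + f {v, z}"
proof (cases "z \<in> set p")
  case True
  then obtain ys zs where p_eq: "p = ys @ z # zs"
    by (meson split_list)
  have "graph_path G u (ys @ [z]) z"
    using p unfolding graph_path_def p_eq path_edges_append[of ys z zs] by (cases ys) auto
  moreover have "sum_list (map f (path_edges (ys @ [z]))) \<le> sum_list (map f (path_edges p)) + f {v, z}"
    unfolding p_eq path_edges_append[of ys z zs] by (simp add: add.assoc)
  ultimately show thesis by (rule that)
next
  case False
  obtain ys where p_eq: "p = ys @ [v]"
    using p append_butlast_last_id[of p] unfolding graph_path_def by metis
  have e: "path_edges (p @ [z]) = path_edges p @ [{v, z}]"
    using path_edges_append[of ys v "[z]"] by (simp add: p_eq)
  have "graph_path G u (p @ [z]) z"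
    using p z False unfolding graph_path_def e by auto
  moreover have "sum_list (map f (path_edges (p @ [z]))) \<le> sum_list (map f (path_edges p)) + f {v, z}"
    unfolding e by simp
  ultimately show thesis by (rule that)
qed

lemma path_crossing:
  assumes "p \<noteq> []" "hd p \<in> W" "last p \<notin> W" "set (path_edges p) \<subseteq> A"
  shows "\<exists>x y. x \<in> W \<and> y \<notin> W \<and> {x, y} \<in> A"
  using assms
proof (induction p rule: path_edges.induct)
  case (1 x y xs)
  then show ?case by (cases "y \<in> W") auto
qed auto

text \<open>The component containing \<open>t\<close> after deletion of the edge between
  \<open>s\<close> and \<open>t\<close>.\<close>

definition tree_side :: "('t, 'b) ugraph_scheme \<Rightarrow> 't \<Rightarrow> 't \<Rightarrow> 't set" where
  "tree_side T s t = {x. (\<lambda>a b. {a, b} \<in> edges T \<and> {a, b} \<noteq> {s, t})\<^sup>*\<^sup>* t x}"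

lemma tree_side_root: "t \<in> tree_side T s t"
  by (simp add: tree_side_def)

lemma tree_side_step:
  assumes "x \<in> tree_side T s t" "{x, y} \<in> edges T" "{x, y} \<noteq> {s, t}"
  shows "y \<in> tree_side T s t"
  using assms unfolding tree_side_def mem_Collect_eq by (rule_tac rtranclp.rtrancl_into_rtrancl) auto

locale tree_decomp =
  fixes G :: "('a, 'b) ugraph_scheme" and T :: "'t ugraph" and B :: "'t \<Rightarrow> 'a set"
  assumes tree: "finite_tree T" and decomp: "tree_decomposition G T B"
begin

lemma tree_edge:
  assumes "{x, y} \<in> edges T"
  shows "x \<in> verts T" "y \<in> verts T" "x \<noteq> y"
proof -
  obtain u v where "u \<in> verts T" "v \<in> verts T" "u \<noteq> v" "{x, y} = {u, v}"
    using tree assms unfolding finite_tree_def finite_graph_def by blast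
  then show "x \<in> verts T" "y \<in> verts T" "x \<noteq> y"
    by (auto simp: doubleton_eq_iff)
qed

lemma finite_verts: "finite (verts T)"
  using tree by (simp add: finite_tree_def finite_graph_def)

lemma tree_side_subset:
  assumes "{s, t} \<in> edges T"
  shows "tree_side T s t \<subseteq> verts T"
proof
  fix x
  assume "x \<in> tree_side T s t"
  then have "(\<lambda>a b. {a, b} \<in> edges T \<and> {a, b} \<noteq> {s, t})\<^sup>*\<^sup>* t x"
    by (simp add: tree_side_def)
  then show "x \<in> verts T"
    using tree_edge assms by (induction rule: rtranclp_induct) blast+
qed

text \<open>A path from \<open>t\<close> to \<open>s\<close> that avoids the edge would close up
  with it to a cycle; it has at least three vertices because \<open>s\<close> and \<open>t\<close>
  differ and the edge itself is deleted.\<close>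

lemma tree_side_bridge:
  assumes st: "{s, t} \<in> edges T"
  shows "s \<notin> tree_side T s t"
proof
  let ?T = "T\<lparr>edges := edges T - {{s, t}}\<rparr>"
  have "\<exists>p. graph_path ?T t p x" if "(\<lambda>a b. {a, b} \<in> edges T \<and> {a, b} \<noteq> {s, t})\<^sup>*\<^sup>* t x" for x
    using that
  proof (induction rule: rtranclp_induct)
    case base
    have "graph_path ?T t [t] t"
      using tree_edge[OF st] by (simp add: graph_path_def)
    then show ?case by blast
  next
    case (step y z)
    then obtain p where "graph_path ?T t p y"
      by blast
    then show ?case
      using step.hyps tree_edge[of y z] graph_path_extend[of ?T t p y z "\<lambda>_. 0"] by auto
  qed
  moreover assume "s \<in> tree_side T s t"
  ultimately have "\<exists>p. graph_path ?T t p s"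
    by (simp add: tree_side_def)
  then obtain p where p: "p \<noteq> []" "hd p = t" "last p = s" "distinct p" "set p \<subseteq> verts T"
    "set (path_edges p) \<subseteq> edges T - {{s, t}}"
    by (auto simp: graph_path_def)
  have "s \<noteq> t"
    using tree_edge[OF st] by simp
  have "length p \<ge> 3"
  proof (rule ccontr)
    assume "\<not> 3 \<le> length p"
    then consider x where "p = [x]" | x y where "p = [x, y]"
      using p(1) by (cases p; cases "tl p") (auto simp: Suc_le_eq)
    then show False
      using p \<open>s \<noteq> t\<close> by cases auto
  qed
  then have "graph_cycle T p"
    using p st by (auto simp: graph_cycle_def)
  then show False
    using tree by (auto simp: finite_tree_def)
qed

lemma tree_side_exit:
  assumes "{s, t} \<in> edges T" "x \<in> tree_side T s t" "y \<notin> tree_side T s t" "{x, y} \<in> edges T"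
  shows "x = t \<and> y = s"
proof -
  have "{x, y} = {s, t}"
    using tree_side_step assms(2-4) by metis
  then show ?thesis
    using tree_side_bridge[OF assms(1)] assms(2) by (auto simp: doubleton_eq_iff)
qed

text \<open>A walk in the side of \<open>u\<close> never meets \<open>t\<close>, so it does not use
  the edge to \<open>s\<close>. Strictness provides the induction measure for
  \<open>rooted_decomp_side\<close>.\<close>

lemma tree_side_psubset:
  assumes st: "{s, t} \<in> edges T" and tu: "{t, u} \<in> edges T" and "u \<noteq> s"
  shows "tree_side T t u \<subset> tree_side T s t"
proof
  show "tree_side T t u \<subseteq> tree_side T s t"
  proof
    fix x
    assume "x \<in> tree_side T t u"
    then have "(\<lambda>a b. {a, b} \<in> edges T \<and> {a, b} \<noteq> {t, u})\<^sup>*\<^sup>* u x"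
      by (simp add: tree_side_def)
    then show "x \<in> tree_side T s t"
    proof (induction rule: rtranclp_induct)
      case base
      then show ?case
        using tree_side_step[OF tree_side_root tu] \<open>u \<noteq> s\<close> tree_edge[OF st] by (auto simp: doubleton_eq_iff)
    next
      case (step y z)
      have "y \<in> tree_side T t u"
        using step.hyps by (simp add: tree_side_def)
      then have "y \<in> tree_side T t u" "z \<in> tree_side T t u"
        using tree_side_step[of y T t u z] step.hyps by auto
      then have "y \<noteq> t" "z \<noteq> t"
        using tree_side_bridge[OF tu] by auto
      then show ?case
        using tree_side_step[OF step.IH, of z] step.hyps(2) by (auto simp: doubleton_eq_iff)
    qed
  qed
  show "tree_side T t u \<noteq> tree_side T s t"
    using tree_side_root[of t T s] tree_side_bridge[OF tu] by auto
qed

lemma tree_side_children: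
  assumes st: "{s, t} \<in> edges T"
  shows "tree_side T s t = insert t (\<Union>u\<in>{u. {t, u} \<in> edges T \<and> u \<noteq> s}. tree_side T t u)" (is "_ = ?R")
proof
  show "tree_side T s t \<subseteq> ?R"
  proof
    fix x
    assume "x \<in> tree_side T s t"
    then have "(\<lambda>a b. {a, b} \<in> edges T \<and> {a, b} \<noteq> {s, t})\<^sup>*\<^sup>* t x"
      by (simp add: tree_side_def)
    then show "x \<in> ?R"
    proof (induction rule: rtranclp_induct)
      case (step y z)
      show ?case
      proof (cases "y = t")
        case True
        then show ?thesis
          using step.hyps(2) tree_side_root[of z T t] by auto
      next
        case False
        then obtain u where u: "{t, u} \<in> edges T" "u \<noteq> s" "y \<in> tree_side T t u"
          using step.IH by auto
        then show ?thesis
          using tree_side_exit[OF u(1,3), of z] step.hyps(2) by auto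
      qed
    qed simp
  qed
  show "?R \<subseteq> tree_side T s t"
    using tree_side_root[of t T s] tree_side_psubset[OF st] by blast
qed

text \<open>A walk in the side of \<open>u\<close> never meets \<open>t\<close>, the only entrance
  to the side of \<open>v\<close>.\<close>

lemma tree_side_disjoint:
  assumes tu: "{t, u} \<in> edges T" and tv: "{t, v} \<in> edges T" and "u \<noteq> v"
  shows "tree_side T t u \<inter> tree_side T t v = {}"
proof -
  have "x \<notin> tree_side T t v" if "x \<in> tree_side T t u" for x
  proof -
    have "(\<lambda>a b. {a, b} \<in> edges T \<and> {a, b} \<noteq> {t, u})\<^sup>*\<^sup>* u x"
      using that by (simp add: tree_side_def)
    then show ?thesis
    proof (induction rule: rtranclp_induct)
      case base
      show ?case
      proof
        assume "u \<in> tree_side T t v"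
        then have "t \<in> tree_side T t v"
          using tree_side_step[of u T t v t] tu \<open>u \<noteq> v\<close> tree_edge[OF tv]
          by (auto simp: doubleton_eq_iff insert_commute)
        with tree_side_bridge[OF tv] show False by simp
      qed
    next
      case (step y z)
      have "y \<in> tree_side T t u"
        using step.hyps by (auto simp: tree_side_def)
      then have "y \<noteq> t"
        using tree_side_bridge[OF tu] by auto
      then show ?case
        using tree_side_exit[OF tv, of z y] step by (auto simp: insert_commute)
    qed
  qed
  then show ?thesis by blast
qed

text \<open>The nodes whose bags contain \<open>v\<close> are connected, so a path among them from
  \<open>x\<close> to \<open>y\<close> uses the edge between \<open>s\<close> and
  \<open>t\<close>.\<close>

lemma tree_side_adhesion:
  assumes st: "{s, t} \<in> edges T" and x: "x \<in> tree_side T s t" "v \<in> B x"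
    and y: "y \<in> verts T" "y \<notin> tree_side T s t" "v \<in> B y"
  shows "v \<in> B s \<inter> B t"
proof -
  let ?S = "induced_subgraph T {t. v \<in> B t}"
  have xT: "x \<in> verts T"
    using tree_side_subset[OF st] x by auto
  then have "v \<in> verts G"
    using decomp x unfolding tree_decomposition_def by blast
  then have "graph_connected ?S"
    using decomp unfolding tree_decomposition_def by blast
  then obtain p where "graph_path ?S x p y"
    using xT x y unfolding graph_connected_def induced_subgraph_def by fastforce
  then obtain a b where ab: "a \<in> tree_side T s t" "b \<notin> tree_side T s t" "{a, b} \<in> edges ?S"
    using path_crossing[of p "tree_side T s t" "edges ?S"] x y by (auto simp: graph_path_def)
  then have e: "{a, b} \<in> edges T" "v \<in> B a" "v \<in> B b"
    by (auto simp: induced_subgraph_def)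
  then show ?thesis
    using tree_side_exit[OF st ab(1,2) e(1)] by auto
qed

text \<open>The sides at \<open>t\<close> are glued on one neighbour at a time. \<open>N\<close> is
  all neighbours for the root and omits the parent for other nodes.\<close>

lemma rooted_decomp_star:
  assumes "finite N" "N \<subseteq> {u. {t, u} \<in> edges T}" "P (B t)"
    and gated: "\<And>s t. {s, t} \<in> edges T \<Longrightarrow> gated d H (B s \<inter> B t) (\<Union>(B ` tree_side T s t))"
    and sub: "\<And>u. u \<in> N \<Longrightarrow> rooted_decomp d P H (B u) (\<Union>(B ` tree_side T t u))"
  shows "rooted_decomp d P H (B t) (\<Union>(B ` insert t (\<Union>u\<in>N. tree_side T t u)))"
  using assms(1,2) sub
proof (induction N rule: finite_induct)
  case empty
  then show ?case
    using assms(3) by (auto intro: rooted_decomp.leaf)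
next
  case (insert u N)
  let ?S = "insert t (\<Union>u\<in>N. tree_side T t u)"
  have tu: "{t, u} \<in> edges T"
    using insert.prems by simp
  have out: "x \<in> verts T \<and> x \<notin> tree_side T t u" if "x \<in> ?S" for x
    using that
  proof (elim insertE UN_E)
    assume "x = t"
    then show ?thesis
      using tree_edge[OF tu] tree_side_bridge[OF tu] by simp
  next
    fix u'
    assume u': "u' \<in> N" "x \<in> tree_side T t u'"
    then have "{t, u'} \<in> edges T" "u' \<noteq> u"
      using insert by auto
    then show ?thesis
      using tree_side_disjoint[OF tu] tree_side_subset u' by blast
  qed
  have "rooted_decomp d P H (B t) (\<Union>(B ` ?S) \<union> \<Union>(B ` tree_side T t u))"
  proof (rule rooted_decomp.glue)
    show "rooted_decomp d P H (B t) (\<Union>(B ` ?S))"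
      using insert by auto
    show "rooted_decomp d P H (B u) (\<Union>(B ` tree_side T t u))"
      using insert.prems by simp
    show "\<Union>(B ` ?S) \<inter> \<Union>(B ` tree_side T t u) \<subseteq> B t \<inter> B u"
      using tree_side_adhesion[OF tu] out by blast
    show "gated d H (B t \<inter> B u) (\<Union>(B ` tree_side T t u))"
      using gated[OF tu] .
  qed
  moreover have "\<Union>(B ` ?S) \<union> \<Union>(B ` tree_side T t u) =
      \<Union>(B ` insert t (\<Union>u\<in>insert u N. tree_side T t u))"
    by auto
  ultimately show ?case by simp
qed

lemma finite_neighbours: "finite {u. {t, u} \<in> edges T \<and> Q u}"
  by (rule finite_subset[OF _ finite_verts]) (use tree_edge in auto)

lemma rooted_decomp_side:
  assumes "{s, t} \<in> edges T" and P: "\<And>t. t \<in> verts T \<Longrightarrow> P (B t)"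
    and gated: "\<And>s t. {s, t} \<in> edges T \<Longrightarrow> gated d H (B s \<inter> B t) (\<Union>(B ` tree_side T s t))"
  shows "rooted_decomp d P H (B t) (\<Union>(B ` tree_side T s t))"
  using assms(1)
proof (induction "card (tree_side T s t)" arbitrary: s t rule: less_induct)
  case less
  have fin: "finite (tree_side T s t)"
    using tree_side_subset[OF less.prems] finite_verts finite_subset by blast
  show ?case
    unfolding tree_side_children[OF less.prems]
  proof (rule rooted_decomp_star[OF finite_neighbours _ _ gated])
    fix u
    assume "u \<in> {u. {t, u} \<in> edges T \<and> u \<noteq> s}"
    then show "rooted_decomp d P H (B u) (\<Union>(B ` tree_side T t u))"
      using less.hyps[of t u] tree_side_psubset[OF less.prems, of u] psubset_card_mono[OF fin] by simp
  qed (use P tree_edge[OF less.prems] in auto)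
qed

lemma rooted_decomp_tree:
  assumes P: "\<And>t. t \<in> verts T \<Longrightarrow> P (B t)"
    and gated: "\<And>s t. {s, t} \<in> edges T \<Longrightarrow> gated d H (B s \<inter> B t) (\<Union>(B ` tree_side T s t))"
  shows "\<exists>X. rooted_decomp d P H X (verts G)"
proof -
  have conn: "graph_connected T"
    using tree by (simp add: finite_tree_def)
  then obtain t where t: "t \<in> verts T"
    by (auto simp: graph_connected_def)
  \<comment> \<open>The conjunct \<open>True\<close> matches the form of
    \<open>finite_neighbours\<close>; the root has no parent to leave out.\<close>
  let ?N = "{u. {t, u} \<in> edges T \<and> True}"
  let ?S = "insert t (\<Union>u\<in>?N. tree_side T t u)"
  have "x \<in> ?S" if x: "x \<in> verts T" for x
  proof (rule ccontr)
    assume "x \<notin> ?S"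
    obtain p where "graph_path T t p x"
      using conn t x by (auto simp: graph_connected_def)
    then obtain a b where ab: "a \<in> ?S" "b \<notin> ?S" "{a, b} \<in> edges T"
      using path_crossing[of p ?S "edges T"] \<open>x \<notin> ?S\<close> by (auto simp: graph_path_def)
    have "a \<noteq> t"
      using ab tree_side_root[of b T t] by auto
    then obtain u where "{t, u} \<in> edges T" "a \<in> tree_side T t u"
      using ab by auto
    then show False
      using tree_side_exit[of t u a b] ab by auto
  qed
  moreover have "?S \<subseteq> verts T"
    using t tree_side_subset by blast
  ultimately have "?S = verts T" by blast
  moreover have "rooted_decomp d P H (B t) (\<Union>(B ` ?S))"
    by (rule rooted_decomp_star[OF finite_neighbours _ _ gated])
      (use P t rooted_decomp_side[of _ _ P, OF _ P gated] in auto)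
  ultimately show ?thesis
    using decomp by (auto simp: tree_decomposition_def)
qed

end

section \<open>Rescaled weighted graphs\<close>

definition scaled_weight :: "'a wgraph \<Rightarrow> ennreal \<Rightarrow> 'a \<Rightarrow> 'a \<Rightarrow> ennreal" where
  "scaled_weight G s x y = (if {x, y} \<in> edges G then s * weight G {x, y} else top)"

abbreviation scaled_dist :: "'a wgraph \<Rightarrow> ennreal \<Rightarrow> 'a \<Rightarrow> 'a \<Rightarrow> ennreal" where
  "scaled_dist G s \<equiv> path_metric (scaled_weight G s)"

lemma pseudometric_scaled_dist: "pseudometric (scaled_dist G s)"
  by (rule pseudometric_path_metric) (simp add: scaled_weight_def insert_commute)

lemma finite_graph_edge:
  assumes "finite_graph G" "{x, y} \<in> edges G"
  shows "x \<in> verts G" "y \<in> verts G"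
proof -
  obtain u v where "u \<in> verts G" "v \<in> verts G" "{x, y} = {u, v}"
    using assms unfolding finite_graph_def by blast
  then show "x \<in> verts G" "y \<in> verts G"
    by (auto simp: doubleton_eq_iff)
qed

lemma graph_path_walk_length:
  assumes "p \<noteq> []" "set (path_edges p) \<subseteq> edges G"
  shows "walk_length (scaled_weight G s) (hd p) (last p) (s * path_length G p)"
  using assms
proof (induction p rule: path_edges.induct)
  case (1 x y xs)
  have "walk_length (scaled_weight G s) x y (s * weight G {x, y})"
    using walk_snoc[OF walk_Nil, of "scaled_weight G s" x y] 1 by (simp add: scaled_weight_def)
  moreover have "walk_length (scaled_weight G s) y (last (y # xs)) (s * path_length G (y # xs))"
    using 1 by simp
  ultimately have "walk_length (scaled_weight G s) x (last (y # xs))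
      (s * weight G {x, y} + s * path_length G (y # xs))"
    by (rule walk_length_append[rotated])
  then show ?case
    by (simp add: path_length_def distrib_left)
qed (simp_all add: path_length_def walk_Nil)

text \<open>\<open>graph_path_extend\<close> turns the walk into a path step by step without
  increasing the length.\<close>

lemma walk_length_graph_path:
  assumes "walk_length (scaled_weight G s) u v t" "finite_graph G" "u \<in> verts G" "t < top"
  shows "\<exists>p. graph_path G u p v \<and> s * path_length G p \<le> t"
  using assms(1,3,4)
proof (induction rule: walk_length.induct)
  case (walk_Nil x)
  then have "graph_path G x [x] x \<and> s * path_length G [x] \<le> 0"
    by (simp add: graph_path_def path_length_def)
  then show ?case by blast
next
  case (walk_snoc x y t z)
  have fin: "t < top" "scaled_weight G s y z < top"
    using walk_snoc.prems by (auto simp: less_top[symmetric])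
  then obtain p where p: "graph_path G x p y" "s * path_length G p \<le> t"
    using walk_snoc.IH walk_snoc.prems by blast
  have e: "{y, z} \<in> edges G"
    using fin(2) by (auto simp: scaled_weight_def split: if_splits)
  obtain q where q: "graph_path G x q z"
    "path_length G q \<le> path_length G p + weight G {y, z}"
    using graph_path_extend[OF p(1) finite_graph_edge(2)[OF assms(2) e] e, of "weight G"]
    unfolding path_length_def by blast
  have "s * path_length G q \<le> s * path_length G p + s * weight G {y, z}"
    using q(2) mult_left_mono[of _ _ s] by (simp flip: distrib_left)
  also have "\<dots> \<le> t + scaled_weight G s y z"
    using p(2) e by (simp add: scaled_weight_def add_right_mono)
  finally show ?case
    using q(1) by blast
qed

section \<open>Comparing the rescaled metric with the graph distance\<close>

lemma inverse_scale: "r > 0 \<Longrightarrow> ennreal r * ennreal (1 / r) = 1"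
  by (simp flip: ennreal_mult)

lemma scaled_dist_le_wdist:
  assumes "r > 0"
  shows "ennreal r * scaled_dist G (ennreal (1 / r)) u v \<le> wdist G u v"
  unfolding wdist_def
proof (rule INF_greatest)
  fix p
  assume "p \<in> {p. graph_path G u p v}"
  then have "scaled_dist G (ennreal (1 / r)) u v \<le> ennreal (1 / r) * path_length G p"
    using path_metric_le[OF graph_path_walk_length[of p G "ennreal (1 / r)"]]
    by (auto simp: graph_path_def)
  then have "ennreal r * scaled_dist G (ennreal (1 / r)) u v
      \<le> ennreal r * (ennreal (1 / r) * path_length G p)"
    by (rule mult_left_mono) simp
  then show "ennreal r * scaled_dist G (ennreal (1 / r)) u v \<le> path_length G p"
    by (simp add: mult.assoc[symmetric] inverse_scale[OF assms])
qed

lemma dist_le_of_wdist: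
  assumes "r > 0" "wdist G u v \<le> ennreal r"
  shows "dist_le (scaled_dist G (ennreal (1 / r))) 1 u v"
proof -
  have "ennreal r * scaled_dist G (ennreal (1 / r)) u v \<le> ennreal r"
    using scaled_dist_le_wdist[OF assms(1)] assms(2) by (rule order_trans)
  then have "ennreal (1 / r) * (ennreal r * scaled_dist G (ennreal (1 / r)) u v)
      \<le> ennreal (1 / r) * ennreal r"
    by (rule mult_left_mono) simp
  moreover have "ennreal (1 / r) * ennreal r = 1"
    using inverse_scale[OF assms(1)] by (simp only: mult.commute)
  ultimately show ?thesis
    by (simp add: dist_le_def mult.assoc[symmetric])
qed

text \<open>The extra unit makes the infimum strictly less than \<open>Suc D\<close>, which yields a
  walk of length below \<open>Suc D\<close> without an argument that the infimum is
  attained.\<close>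

lemma wdist_of_dist_le:
  assumes "r > 0" "finite_graph G" "u \<in> verts G" "dist_le (scaled_dist G (ennreal (1 / r))) D u v"
  shows "wdist G u v \<le> ennreal ((real D + 1) * r)"
proof -
  have "scaled_dist G (ennreal (1 / r)) u v < of_nat (Suc D)"
    using assms(4) unfolding dist_le_def
    by (rule le_less_trans) (simp add: ennreal_of_nat_eq_real_of_nat ennreal_less_iff del: of_nat_Suc)
  then obtain t where t: "walk_length (scaled_weight G (ennreal (1 / r))) u v t" "t < of_nat (Suc D)"
    unfolding path_metric_def Inf_less_iff by blast
  have "t < top"
    using t(2) of_nat_less_top by (rule less_trans)
  then obtain p where p: "graph_path G u p v" "ennreal (1 / r) * path_length G p \<le> t"
    using walk_length_graph_path[OF t(1) assms(2,3)] by blast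
  have "wdist G u v \<le> path_length G p"
    unfolding wdist_def using p(1) by (intro INF_lower) simp
  also have "\<dots> = ennreal r * (ennreal (1 / r) * path_length G p)"
    by (simp add: mult.assoc[symmetric] inverse_scale[OF assms(1)])
  also have "\<dots> \<le> ennreal r * of_nat (Suc D)"
    using p(2) t(2) by (intro mult_left_mono) auto
  also have "\<dots> = ennreal r * ennreal (real (Suc D))"
    by (simp only: ennreal_of_nat_eq_real_of_nat)
  also have "\<dots> = ennreal (r * real (Suc D))"
    using assms(1) by (intro ennreal_mult[symmetric]) auto
  also have "r * real (Suc D) = (real D + 1) * r"
    by (simp add: algebra_simps)
  finally show ?thesis .
qed

section \<open>From treewidth to rooted decompositions\<close>

lemma treewidth_decomposition:
  fixes G :: "('a, 'b) ugraph_scheme"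
  assumes "finite_graph G"
  shows "\<exists>(T :: nat ugraph) B. tree_decomposition G T B \<and> decomposition_width T B = treewidth G"
  unfolding treewidth_def
proof (rule LeastI_ex)
  let ?T = "\<lparr>verts = {0}, edges = {}\<rparr> :: nat ugraph"
  have path: "graph_path H 0 [0] 0" if "0 \<in> verts H" for H :: "nat ugraph"
    using that by (simp add: graph_path_def)
  have "\<not> graph_cycle ?T p" for p
    by (auto simp: graph_cycle_def)
  then have "finite_tree ?T"
    using path[of ?T] by (auto simp: finite_tree_def finite_graph_def graph_connected_def)
  moreover have "graph_connected (induced_subgraph ?T {t. v \<in> verts G})" if "v \<in> verts G" for v
    using that path[of "induced_subgraph ?T {t. v \<in> verts G}"]
    by (auto simp: graph_connected_def induced_subgraph_def)
  ultimately have "tree_decomposition G ?T (\<lambda>_. verts G)"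
    using assms by (auto simp: tree_decomposition_def finite_graph_def)
  then show "\<exists>w (T :: nat ugraph) B. tree_decomposition G T B \<and> decomposition_width T B = w"
    by blast
qed

text \<open>If an edge leaves a side at \<open>x\<close>, the bag containing the edge belongs to a
  node outside the side. So \<open>x\<close> is in the adhesion set and is itself the gate.\<close>

lemma scaled_dist_rooted_decomp:
  fixes G :: "'a wgraph"
  assumes G: "finite_graph G" and "treewidth G \<le> k"
  shows "\<exists>X. rooted_decomp (scaled_dist G s) (\<lambda>B. finite B \<and> card B \<le> Suc k) (verts G) X (verts G)"
proof -
  obtain T :: "nat ugraph" and B where TB: "tree_decomposition G T B" "decomposition_width T B = treewidth G"
    using treewidth_decomposition[OF G] by blast
  interpret tree_decomp G T B
    using TB(1) by unfold_locales (simp_all add: tree_decomposition_def)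
  have "(\<Union>t\<in>verts T. B t) = verts G"
    using TB(1) by (simp add: tree_decomposition_def)
  then have B: "finite (B t)" if "t \<in> verts T" for t
    using that G finite_subset[of "B t" "verts G"] unfolding finite_graph_def by blast
  have "card (B t) \<le> Suc k" if "t \<in> verts T" for t
  proof -
    have "card (B t) \<le> Max ((\<lambda>t. card (B t)) ` verts T)"
      using finite_verts that by (intro Max_ge) auto
    then show ?thesis
      using TB(2) assms(2) by (simp add: decomposition_width_def)
  qed
  then have P: "finite (B t) \<and> card (B t) \<le> Suc k" if "t \<in> verts T" for t
    using B that by simp
  have gated: "gated (scaled_dist G s) (verts G) (B a \<inter> B b) (\<Union>(B ` tree_side T a b))"
    if ab: "{a, b} \<in> edges T" for a b
  proof (rule gated_path_metric)
    show "finite (B a \<inter> B b)"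
      using B tree_edge[OF ab] by simp
    show "scaled_weight G s x y = top" if "x \<notin> verts G" for x y
      using that finite_graph_edge(1)[OF G, of x y] unfolding scaled_weight_def by metis
    fix x y
    assume x: "x \<in> \<Union>(B ` tree_side T a b)" and y: "y \<in> verts G - \<Union>(B ` tree_side T a b)"
      and fin: "scaled_weight G s x y < top"
    have "{x, y} \<in> edges G"
      using fin by (simp add: scaled_weight_def split: if_splits)
    then obtain t where t: "t \<in> verts T" "x \<in> B t" "y \<in> B t"
      using TB(1) unfolding tree_decomposition_def by (metis insert_subset)
    moreover have "t \<notin> tree_side T a b"
      using y t by blast
    moreover obtain t' where "t' \<in> tree_side T a b" "x \<in> B t'"
      using x by blast
    ultimately have "x \<in> B a \<inter> B b"
      using tree_side_adhesion[OF ab, of t' x t] by simp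
    moreover have "scaled_dist G s x x + scaled_dist G s x y \<le> scaled_weight G s x y"
      using path_metric_le[OF walk_Nil, of "scaled_weight G s" x]
        path_metric_le_weight[of "scaled_weight G s" x y] by simp
    ultimately show "\<exists>z\<in>B a \<inter> B b. scaled_dist G s x z + scaled_dist G s z y \<le> scaled_weight G s x y"
      by blast
  qed
  show ?thesis
    by (rule rooted_decomp_tree) (fact P, fact gated)
qed

theorem theorem13:
  fixes k :: nat and \<G> :: "'a wgraph set"
  assumes "\<And>G. G \<in> \<G> \<Longrightarrow> weighted_graph G"
    and "\<And>G. G \<in> \<G> \<Longrightarrow> treewidth G \<le> k"
  shows "assouad_nagata_dim \<G> \<le> 1"
proof -
  \<comment> \<open>Bags have at most \<open>k + 1\<close> points, and the step is 1 after
    rescaling. \<open>D\<close> is fixed before \<open>G\<close> and \<open>r\<close>, which makes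
    the control function linear.\<close>
  obtain D where D: "\<And>d H X V. pseudometric d \<Longrightarrow>
      rooted_decomp d (\<lambda>B. finite B \<and> card B \<le> Suc k) H X V \<Longrightarrow> V \<subseteq> H \<Longrightarrow>
      extendable (d :: 'a \<Rightarrow> 'a \<Rightarrow> ennreal) 1 0 D X V"
    using rooted_decomp_extendable[of "Suc k" 1 0] by blast
  define f where "f r = (real D + 1) * r" for r
  have "\<exists>(C :: nat set) c. mrd_colouring G (1 + 1) r (f r) C c" if mem: "G \<in> \<G>" and "r > 0" for G r
  proof -
    let ?d = "scaled_dist G (ennreal (1 / r))"
    have G: "finite_graph G"
      using assms(1)[OF mem] by (simp add: weighted_graph_def)
    obtain X where "rooted_decomp ?d (\<lambda>B. finite B \<and> card B \<le> Suc k) (verts G) X (verts G)"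
      using scaled_dist_rooted_decomp[OF G assms(2)[OF mem]] by blast
    from D[OF pseudometric_scaled_dist this] obtain c where c: "mono_bounded ?d (verts G) c 1 D"
      unfolding extendable_def by blast
    have "wdiam G (set p) \<le> ennreal (f r)"
      if p: "r_path G r p" and mono: "\<exists>a. \<forall>x\<in>set p. of_bool (c x) = (a :: nat)" for p
    proof -
      have col: "c x = c y" if "x \<in> set p" "y \<in> set p" for x y
        using mono that by (auto simp: of_bool_def split: if_splits)
      have reach: "(mono_step ?d (verts G) c 1)\<^sup>*\<^sup>* (p ! 0) (p ! i)" if "i < length p" for i
        using that
      proof (induction i)
        case (Suc i)
        have "wdist G (p ! i) (p ! Suc i) \<le> ennreal r"
          using p Suc.prems by (simp add: r_path_def)
        then have "dist_le ?d 1 (p ! i) (p ! Suc i)"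
          by (rule dist_le_of_wdist[OF \<open>r > 0\<close>])
        moreover have "p ! i \<in> set p" "p ! Suc i \<in> set p"
          using Suc.prems by simp_all
        ultimately have "mono_step ?d (verts G) c 1 (p ! i) (p ! Suc i)"
          using p col[of "p ! i" "p ! Suc i"] unfolding mono_step_def r_path_def by blast
        moreover have "(mono_step ?d (verts G) c 1)\<^sup>*\<^sup>* (p ! 0) (p ! i)"
          using Suc by simp
        ultimately show ?case
          by (rule rtranclp.rtrancl_into_rtrancl[rotated])
      qed simp
      have "wdist G u v \<le> ennreal (f r)" if uv: "u \<in> set p" "v \<in> set p" for u v
      proof -
        obtain i j where "i < length p" "u = p ! i" "j < length p" "v = p ! j"
          using uv by (auto simp: in_set_conv_nth)
        then have "(mono_step ?d (verts G) c 1)\<^sup>*\<^sup>* u v"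
          using rtranclp_trans[OF mono_step_rtranclp_sym[OF pseudometric_scaled_dist reach] reach] by simp
        then have "dist_le ?d D u v"
          using c by (simp add: mono_bounded_def)
        then show ?thesis
          using wdist_of_dist_le[OF \<open>r > 0\<close> G] uv p unfolding f_def r_path_def by blast
      qed
      then show ?thesis
        unfolding wdiam_def by (intro SUP_least)
    qed
    then have "mrd_colouring G (1 + 1) r (f r) {0, 1 :: nat} (\<lambda>x. of_bool (c x))"
      by (auto simp: mrd_colouring_def)
    then show ?thesis by blast
  qed
  moreover have "\<forall>r>0. f r > 0"
    by (simp add: f_def)
  ultimately have "control_function \<G> 1 f"
    by (simp add: control_function_def)
  moreover have "dilation f"
    unfolding dilation_def f_def by (intro exI[of _ "real D + 1"]) simp
  ultimately have "assouad_nagata_dim \<G> \<le> enat 1"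
    unfolding assouad_nagata_dim_def by (intro INF_lower) blast
  then show ?thesis
    by (simp add: one_enat_def)
qed

end
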